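(* Let $\mathfrak{A}$ be a $C^*$-algebra and $H$ a Hilbert $\mathfrak{A}$-module. Let $T\in\mathcal{L}(H)$ have the polar decomposition $T=U|T|$. Then the following statements are equivalent: (i) $T$ is a centered operator; (ii) $[|T^n|,|(T^m)^*|]=0$ for any $m,n\in\mathbb{N}$; (iii) $[|T^n|,|T^*|]=0$ for any $n\in\mathbb{N}$; (iv) $T$ is commutative along any restricted sequence; (v) $T$ is commutative along some restricted sequence; (vi) $[U^m|T|(U^m)^*,|T^n|]=0$ for any $m,n\in\mathbb{N}$; (vii) $[U^n|T|(U^n)^*,|T|]=0$ for any $n\in\mathbb{N}$; (viii) $[|(T^n)^*|,|T|]=0$ for any $n\in\mathbb{N}$; (ix) $[(U^n)^*|T^*|U^n,|T^*|]=0$ for any $n\in\mathbb{N}$; (x) $[(U^m)^*|T^*|U^m,|(T^n)^*|]=0$ for any $m,n\in\mathbb{N}$; (xi) the operators in $\{|T|,\,U|T|U^*,\,U^*|T|U,\,U^2|T|(U^2)^*,\,(U^2)^*|T|U^2,\,\ldots\}$ commute with one another.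
   Context: $\mathbb{N}=\{1,2,3,\ldots\}$. $\mathcal{L}(H)$ is the $C^*$-algebra of adjointable operators on $H$ (maps $T:H\to H$ having an adjoint $T^*$ with $\langle Tx,y\rangle=\langle x,T^*y\rangle$ for all $x,y\in H$). For $S\in\mathcal{L}(H)$, $|S|=(S^*S)^{1/2}$, so $|S^*|=(SS^* )^{1/2}$; $\mathcal{R}(S)$ is the range of $S$ and the bar denotes norm closure. $[A,B]=AB-BA$. A closed submodule $M$ of $H$ is orthogonally complemented if $H=M\dotplus M^\perp$, where $M^\perp=\{x\in H:\langle x,y\rangle=0\text{ for all }y\in M\}$; then $P_M$ is the projection of $H$ onto $M$ along $M^\perp$. $U\in\mathcal{L}(H)$ is a partial isometry if $U^*U$ is a projection. "$T$ has the polar decomposition $T=U|T|$" means: $U\in\mathcal{L}(H)$ is a partial isometry, $T=U|T|$, $\overline{\mathcal{R}(T^* )}$ is orthogonally complemented, and $U^*U=P_{\overline{\mathcal{R}(T^* )}}$ (such a $U$ is unique when it exists). $T\in\mathcal{L}(H)$ is centered if the operators in the sequence $\ldots,T^3(T^3)^*,T^2(T^2)^*,TT^*,T^*T,(T^2)^*T^2,(T^3)^*T^3,\ldots$ mutually commute. A sequence $\{t_n\}_{n=1}^\infty$ is called restricted if $t_n\in\{1,2,\ldots,n\}$ for each $n\in\mathbb{N}$. An operator $T\in\mathcal{L}(H)$ is called commutative along this restricted sequence if $T$ has the polar decomposition $T=U|T|$ and $[U^{t_n}|T|(U^{t_n})^*,|T^{n+1-t_n}|]=0$ for every $n\in\mathbb{N}$.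 *)

theory Defs
  imports "HOL-Analysis.Analysis"
begin

section \<open>\<open>C\<^sup>*\<close>-algebras\<close>

class complex_banach = banach +
  fixes scaleC :: "complex \<Rightarrow> 'a \<Rightarrow> 'a"  (infixr \<open>*\<^sub>C\<close> 75)
  assumes scaleC_add_right: "c *\<^sub>C (x + y) = c *\<^sub>C x + c *\<^sub>C y"
    and scaleC_add_left: "(c + d) *\<^sub>C x = c *\<^sub>C x + d *\<^sub>C x"
    and scaleC_scaleC: "c *\<^sub>C (d *\<^sub>C x) = (c * d) *\<^sub>C x"
    and scaleC_of_real: "complex_of_real r *\<^sub>C x = scaleR r x"
    and norm_scaleC: "norm (c *\<^sub>C x) = cmod c * norm x"

text \<open>No unit is assumed.\<close>

class cstar_algebra = complex_banach + real_normed_algebra +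
  fixes star :: "'a \<Rightarrow> 'a"
  assumes mult_scaleC_left: "(c *\<^sub>C x) * y = c *\<^sub>C (x * y)"
    and mult_scaleC_right: "x * (c *\<^sub>C y) = c *\<^sub>C (x * y)"
    and star_add: "star (x + y) = star x + star y"
    and star_scaleC: "star (c *\<^sub>C x) = cnj c *\<^sub>C star x"
    and star_mult: "star (x * y) = star y * star x"
    and star_star: "star (star x) = x"
    and cstar_identity: "norm (star x * x) = (norm x)\<^sup>2"

text \<open>
  Multiplication of the unitization \<open>\<complex> \<oplus> A\<close>, with unit \<open>(1, 0)\<close>. The spectrum is taken
  in the unitization even if \<open>A\<close> has a unit; this can only add the point \<open>0\<close> and so does
  not affect positivity.
\<close>

definition unitization_mult ::
    "complex \<times> 'a::cstar_algebra \<Rightarrow> complex \<times> 'a \<Rightarrow> complex \<times> 'a" where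
  "unitization_mult v w =
     (fst v * fst w, fst v *\<^sub>C snd w + fst w *\<^sub>C snd v + snd v * snd w)"

definition cstar_spectrum :: "'a::cstar_algebra \<Rightarrow> complex set" where
  "cstar_spectrum a =
     {c. \<not> (\<exists>w. unitization_mult (c, - a) w = (1, 0) \<and> unitization_mult w (c, - a) = (1, 0))}"

definition cstar_positive :: "'a::cstar_algebra \<Rightarrow> bool" where
  "cstar_positive a \<longleftrightarrow> star a = a \<and> cstar_spectrum a \<subseteq> \<real>\<^sub>\<ge>\<^sub>0"


section \<open>Hilbert modules\<close>

text \<open>
  Right modules, with inner product linear in the second variable. The norm of \<open>H\<close> is the one
  induced by the inner product; completeness comes from the type class.
\<close>

locale hilbert_cstar_module =
  fixes act :: "'h::complex_banach \<Rightarrow> 'a::cstar_algebra \<Rightarrow> 'h"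
    and ip :: "'h \<Rightarrow> 'h \<Rightarrow> 'a"
  assumes act_add_left: "act (x + y) a = act x a + act y a"
    and act_add_right: "act x (a + b) = act x a + act x b"
    and act_mult: "act x (a * b) = act (act x a) b"
    and act_scaleC_left: "act (c *\<^sub>C x) a = c *\<^sub>C act x a"
    and act_scaleC_right: "act x (c *\<^sub>C a) = c *\<^sub>C act x a"
    and ip_add_right: "ip x (y + z) = ip x y + ip x z"
    and ip_scaleC_right: "ip x (c *\<^sub>C y) = c *\<^sub>C ip x y"
    and ip_act_right: "ip x (act y a) = ip x y * a"
    and ip_star: "ip y x = star (ip x y)"
    and ip_positive: "cstar_positive (ip x x)"
    and ip_eq_zero_iff: "ip x x = 0 \<longleftrightarrow> x = 0"
    and norm_eq_sqrt_ip: "norm x = sqrt (norm (ip x x))"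


section \<open>Adjointable operators\<close>

definition adjointable :: "('h \<Rightarrow> 'h \<Rightarrow> 'a) \<Rightarrow> ('h \<Rightarrow> 'h) set" where
  "adjointable ip = {T. \<exists>T'. \<forall>x y. ip (T x) y = ip x (T' y)}"

definition adj :: "('h \<Rightarrow> 'h \<Rightarrow> 'a) \<Rightarrow> ('h \<Rightarrow> 'h) \<Rightarrow> ('h \<Rightarrow> 'h)" where
  "adj ip T = (THE T'. \<forall>x y. ip (T x) y = ip x (T' y))"

definition op_spectrum ::
    "('h::complex_banach \<Rightarrow> 'h \<Rightarrow> 'a) \<Rightarrow> ('h \<Rightarrow> 'h) \<Rightarrow> complex set" where
  "op_spectrum ip T =
     {c. \<not> (\<exists>R \<in> adjointable ip.
              (\<lambda>x. c *\<^sub>C x - T x) \<circ> R = id \<and> R \<circ> (\<lambda>x. c *\<^sub>C x - T x) = id)}"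

definition op_positive ::
    "('h::complex_banach \<Rightarrow> 'h \<Rightarrow> 'a) \<Rightarrow> ('h \<Rightarrow> 'h) \<Rightarrow> bool" where
  "op_positive ip T \<longleftrightarrow> T \<in> adjointable ip \<and> adj ip T = T \<and> op_spectrum ip T \<subseteq> \<real>\<^sub>\<ge>\<^sub>0"

definition op_sqrt ::
    "('h::complex_banach \<Rightarrow> 'h \<Rightarrow> 'a) \<Rightarrow> ('h \<Rightarrow> 'h) \<Rightarrow> ('h \<Rightarrow> 'h)" where
  "op_sqrt ip T = (THE R. op_positive ip R \<and> R \<circ> R = T)"

definition op_abs ::
    "('h::complex_banach \<Rightarrow> 'h \<Rightarrow> 'a) \<Rightarrow> ('h \<Rightarrow> 'h) \<Rightarrow> ('h \<Rightarrow> 'h)" where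
  "op_abs ip S = op_sqrt ip (adj ip S \<circ> S)"

definition commutator :: "('h::ab_group_add \<Rightarrow> 'h) \<Rightarrow> ('h \<Rightarrow> 'h) \<Rightarrow> ('h \<Rightarrow> 'h)" where
  "commutator A B = (\<lambda>x. A (B x) - B (A x))"

definition commuting_family :: "('h::ab_group_add \<Rightarrow> 'h) set \<Rightarrow> bool" where
  "commuting_family F \<longleftrightarrow> (\<forall>A\<in>F. \<forall>B\<in>F. commutator A B = (\<lambda>_. 0))"


section \<open>Polar decomposition\<close>

definition orth_compl :: "('h \<Rightarrow> 'h \<Rightarrow> 'a::zero) \<Rightarrow> 'h set \<Rightarrow> 'h set" where
  "orth_compl ip M = {x. \<forall>y\<in>M. ip x y = 0}"

definition orth_complemented ::
    "('h::ab_group_add \<Rightarrow> 'h \<Rightarrow> 'a::zero) \<Rightarrow> 'h set \<Rightarrow> bool" where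
  "orth_complemented ip M \<longleftrightarrow>
     {x + y | x y. x \<in> M \<and> y \<in> orth_compl ip M} = UNIV \<and> M \<inter> orth_compl ip M = {0}"

definition orth_proj ::
    "('h::ab_group_add \<Rightarrow> 'h \<Rightarrow> 'a::zero) \<Rightarrow> 'h set \<Rightarrow> 'h \<Rightarrow> 'h" where
  "orth_proj ip M x = (THE y. y \<in> M \<and> x - y \<in> orth_compl ip M)"

definition projection_op :: "('h \<Rightarrow> 'h \<Rightarrow> 'a) \<Rightarrow> ('h \<Rightarrow> 'h) \<Rightarrow> bool" where
  "projection_op ip P \<longleftrightarrow> P \<in> adjointable ip \<and> adj ip P = P \<and> P \<circ> P = P"

definition partial_isometry :: "('h \<Rightarrow> 'h \<Rightarrow> 'a) \<Rightarrow> ('h \<Rightarrow> 'h) \<Rightarrow> bool" where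
  "partial_isometry ip U \<longleftrightarrow> U \<in> adjointable ip \<and> projection_op ip (adj ip U \<circ> U)"

definition polar_decomposition ::
    "('h::complex_banach \<Rightarrow> 'h \<Rightarrow> 'a::zero) \<Rightarrow> ('h \<Rightarrow> 'h) \<Rightarrow> ('h \<Rightarrow> 'h) \<Rightarrow> bool" where
  "polar_decomposition ip T U \<longleftrightarrow>
     partial_isometry ip U \<and>
     T = U \<circ> op_abs ip T \<and>
     orth_complemented ip (closure (range (adj ip T))) \<and>
     adj ip U \<circ> U = orth_proj ip (closure (range (adj ip T)))"


section \<open>Centered operators and restricted sequences\<close>

definition centered :: "('h::ab_group_add \<Rightarrow> 'h \<Rightarrow> 'a) \<Rightarrow> ('h \<Rightarrow> 'h) \<Rightarrow> bool" where
  "centered ip T \<longleftrightarrow>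
     commuting_family
       ({T ^^ n \<circ> adj ip (T ^^ n) | n. n \<ge> 1} \<union> {adj ip (T ^^ n) \<circ> T ^^ n | n. n \<ge> 1})"

text \<open>Sequences are indexed from \<open>1\<close>; the value at \<open>0\<close> is irrelevant.\<close>

definition restricted_seq :: "(nat \<Rightarrow> nat) \<Rightarrow> bool" where
  "restricted_seq t \<longleftrightarrow> (\<forall>n\<ge>1. t n \<in> {1..n})"

definition commutative_along ::
    "('h::complex_banach \<Rightarrow> 'h \<Rightarrow> 'a::zero) \<Rightarrow> ('h \<Rightarrow> 'h) \<Rightarrow> (nat \<Rightarrow> nat) \<Rightarrow> bool" where
  "commutative_along ip T t \<longleftrightarrow>
     (\<exists>U. polar_decomposition ip T U \<and>
        (\<forall>n\<ge>1. commutator (U ^^ t n \<circ> op_abs ip T \<circ> adj ip (U ^^ t n))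
                           (op_abs ip (T ^^ (n + 1 - t n))) = (\<lambda>_. 0)))"

end

theory Submission
  imports Defs
begin

text \<open>
  If \<open>\<bar>T\<^sup>k\<bar>\<close> commutes with \<open>\<bar>T\<^sup>*\<bar> = U \<bar>T\<bar> U\<^sup>*\<close>, then \<open>\<bar>T\<^sup>k\<^sup>+\<^sup>1\<bar> = \<bar>T\<bar> U\<^sup>* \<bar>T\<^sup>k\<bar> U\<close>. Since
  \<open>\<bar>T\<bar>\<close> and \<open>U\<close> have the same kernel, it follows that a self-adjoint \<open>X\<close> commuting with \<open>\<bar>T\<bar>\<close>
  commutes with \<open>\<bar>T\<^sup>k\<^sup>+\<^sup>1\<bar>\<close> iff \<open>U X U\<^sup>*\<close> commutes with \<open>\<bar>T\<^sup>k\<bar>\<close>. Applied to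
  \<open>X = U\<^sup>m \<bar>T\<bar> (U\<^sup>m)\<^sup>*\<close>, this makes all relations \<open>[U\<^sup>m \<bar>T\<bar> (U\<^sup>m)\<^sup>*, \<bar>T\<^sup>k\<bar>] = 0\<close> on a diagonal
  \<open>m + k = n + 1\<close> equivalent once those on smaller diagonals hold, so one relation per diagonal
  gives all of them. As \<open>T\<^sup>* = U\<^sup>* \<bar>T\<^sup>*\<bar>\<close> is again a polar decomposition and \<open>T\<^sup>*\<close> is centered iff
  \<open>T\<close> is, each characterization has a dual.

  The theory of positive operators rests on two facts. A contraction \<open>X\<close> yields \<open>\<surd>(1 - X)\<close> by
  iteration, and commuting self-adjoint \<open>C\<close> and \<open>W\<close> with \<open>C\<^sup>2 + W\<^sup>2 = N\<close> satisfy
  \<open>\<parallel>C\<parallel>\<^sup>2 \<le> N\<close>, because \<open>(C + \<i> W)\<^sup>* (C + \<i> W) = N\<close>. They identify the operators with nonnegative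
  spectrum as the self-adjoint \<open>R\<close> with \<open>\<parallel>M - R\<parallel> \<le> M\<close> for some \<open>M\<close>, without holomorphic
  functional calculus.
\<close>

section \<open>Bounded operators on Banach spaces\<close>

lemma closed_cover_obtain_cball:
  fixes F :: "nat \<Rightarrow> 'a::complete_space set"
  assumes closed_F: "\<And>n. closed (F n)" and cover: "(\<Union>n. F n) = UNIV"
  obtains n x e where "e > 0" "cball x e \<subseteq> F n"
proof -
  have "\<exists>n. interior (F n) \<noteq> {}"
  proof (rule ccontr)
    assume "\<nexists>n. interior (F n) \<noteq> {}"
    then have "Met_TC.mtopology interior_of \<Union> (range F) = {}"
      by (intro Met_TC.metric_Baire_category_alt) (auto simp: complete_UNIV closed_F)
    then show False using cover by simp
  qed
  then show ?thesis using that by (metis ex_in_conv mem_interior_cball)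
qed

lemma uniform_boundedness:
  fixes f :: "'i \<Rightarrow> 'a::banach \<Rightarrow> 'b::real_normed_vector"
  assumes f: "\<And>i. bounded_linear (f i)" and bound: "\<And>x. \<exists>C. \<forall>i. norm (f i x) \<le> C"
  obtains K where "\<And>i x. norm (f i x) \<le> K * norm x"
proof -
  define F where "F n = (\<Inter>i. {x. norm (f i x) \<le> real n})" for n :: nat
  have "closed (F n)" for n
    unfolding F_def
    by (intro closed_INT ballI closed_Collect_le continuous_intros linear_continuous_on f)
  moreover have "\<exists>n. x \<in> F n" for x
  proof -
    obtain C where "\<And>i. norm (f i x) \<le> C" using bound by blast
    moreover obtain n :: nat where "C \<le> real n" using real_arch_simple by blast
    ultimately show ?thesis by (auto simp: F_def intro: order.trans)
  qed
  then have "(\<Union>n. F n) = UNIV" by blast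
  ultimately obtain n x\<^sub>0 e where e: "e > 0" "cball x\<^sub>0 e \<subseteq> F n"
    by (rule closed_cover_obtain_cball)
  have "norm (f i x) \<le> (2 * real n / e) * norm x" for i x
  proof (cases "x = 0")
    case True
    then show ?thesis using linear_0[OF bounded_linear.linear[OF f]] by simp
  next
    case False
    interpret bounded_linear "f i" by (rule f)
    define u where "u = (e / norm x) *\<^sub>R x"
    have "x\<^sub>0 + u \<in> F n" "x\<^sub>0 \<in> F n" using e False by (auto simp: u_def dist_norm)
    then have "norm (f i (x\<^sub>0 + u)) \<le> real n" "norm (f i x\<^sub>0) \<le> real n" by (auto simp: F_def)
    then have "norm (f i u) \<le> 2 * real n"
      using norm_triangle_ineq4[of "f i (x\<^sub>0 + u)" "f i x\<^sub>0"] by (simp add: add)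
    then show ?thesis using e False by (simp add: u_def scaleR field_simps)
  qed
  then show ?thesis by (rule that)
qed

lemma bij_scaleR_diff:
  fixes E :: "'a::banach \<Rightarrow> 'a"
  assumes E: "linear E" and q: "0 \<le> q" "q < r" "\<And>x. norm (E x) \<le> q * norm x"
  shows "bij (\<lambda>x. r *\<^sub>R x - E x)"
proof -
  have "\<exists>!x. (y + E x) /\<^sub>R r = x" for y
  proof (rule banach_fix_type[of "q / r"])
    show "\<forall>x x'. dist ((y + E x) /\<^sub>R r) ((y + E x') /\<^sub>R r) \<le> q / r * dist x x'"
      using q by (simp add: dist_norm divide_simps mult.commute
          flip: scaleR_diff_right linear_diff[OF E])
  qed (use q in auto)
  moreover have "(y + E x) /\<^sub>R r = x \<longleftrightarrow> r *\<^sub>R x - E x = y" for x y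
    using q divideR_right[of r x "y + E x"] by (auto simp: algebra_simps)
  ultimately show ?thesis by (simp add: bij_iff)
qed

definition commuting :: "('a \<Rightarrow> 'a) \<Rightarrow> ('a \<Rightarrow> 'a) \<Rightarrow> bool" where
  "commuting A B \<longleftrightarrow> (\<forall>x. A (B x) = B (A x))"

lemma commutingI: "(\<And>x. A (B x) = B (A x)) \<Longrightarrow> commuting A B"
  by (simp add: commuting_def)

lemma commutingD: "commuting A B \<Longrightarrow> A (B x) = B (A x)"
  by (simp add: commuting_def)

lemma commuting_sym: "commuting A B \<Longrightarrow> commuting B A"
  by (simp add: commuting_def)

lemma commuting_refl: "commuting A A"
  by (simp add: commuting_def)

lemma commuting_comp: "commuting A B \<Longrightarrow> commuting A C \<Longrightarrow> commuting A (\<lambda>x. B (C x))"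
  by (simp add: commuting_def)

lemma commuting_inverse:
  assumes "commuting A B" and "\<And>x. B (R x) = x" "\<And>x. R (B x) = x"
  shows "commuting A R"
  using assms unfolding commuting_def by metis

lemma commutator_eq_zero_iff: "commutator A B = (\<lambda>_. 0) \<longleftrightarrow> commuting A B"
  by (simp add: commutator_def commuting_def fun_eq_iff)

section \<open>Square roots near the identity\<close>

text \<open>
  If \<open>\<parallel>X\<parallel> \<le> 1\<close>, then \<open>Y = 1 - \<surd>(1 - X)\<close> is the limit of the iterates of \<open>Y \<mapsto> (X + Y\<^sup>2) / 2\<close>. The
  same iteration for the scalar \<open>X = 1\<close> majorizes the increments.
\<close>

primrec sqrt_defect_approx :: "('a::real_vector \<Rightarrow> 'a) \<Rightarrow> nat \<Rightarrow> 'a \<Rightarrow> 'a" where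
  "sqrt_defect_approx X 0 = (\<lambda>x. 0)"
| "sqrt_defect_approx X (Suc n) =
    (\<lambda>x. (X x + sqrt_defect_approx X n (sqrt_defect_approx X n x)) /\<^sub>R 2)"

definition sqrt_defect :: "('a::real_normed_vector \<Rightarrow> 'a) \<Rightarrow> 'a \<Rightarrow> 'a" where
  "sqrt_defect X x = lim (\<lambda>n. sqrt_defect_approx X n x)"

primrec sqrt_defect_majorant :: "nat \<Rightarrow> real" where
  "sqrt_defect_majorant 0 = 0"
| "sqrt_defect_majorant (Suc n) = (1 + (sqrt_defect_majorant n)\<^sup>2) / 2"

lemma sqrt_defect_majorant_nonneg: "0 \<le> sqrt_defect_majorant n"
  by (cases n) auto

lemma sqrt_defect_majorant_le_1: "sqrt_defect_majorant n \<le> 1"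
  by (induction n) (auto simp: power_le_one sqrt_defect_majorant_nonneg)

lemma sqrt_defect_majorant_mono: "sqrt_defect_majorant n \<le> sqrt_defect_majorant (Suc n)"
  using zero_le_power2[of "1 - sqrt_defect_majorant n"] by (simp add: power2_diff)

lemma convergent_sqrt_defect_majorant: "convergent sqrt_defect_majorant"
proof (rule Bseq_monoseq_convergent)
  show "Bseq sqrt_defect_majorant"
    by (rule BseqI'[of _ 1]) (simp add: sqrt_defect_majorant_nonneg sqrt_defect_majorant_le_1)
  show "monoseq sqrt_defect_majorant"
    by (intro mono_SucI1 allI sqrt_defect_majorant_mono)
qed

context
  fixes X :: "'a::banach \<Rightarrow> 'a"
  assumes bounded_linear_X: "bounded_linear X" and norm_X_le: "\<And>x. norm (X x) \<le> norm x"
begin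

lemma bounded_linear_sqrt_defect_approx: "bounded_linear (sqrt_defect_approx X n)"
proof (induction n)
  case (Suc n)
  show ?case
    unfolding sqrt_defect_approx.simps
    by (intro bounded_linear_scaleR_right[THEN bounded_linear_compose] bounded_linear_add
        bounded_linear_X bounded_linear_compose[OF Suc Suc])
qed simp

lemma sqrt_defect_approx_diff:
  "sqrt_defect_approx X n (x - y) = sqrt_defect_approx X n x - sqrt_defect_approx X n y"
  by (rule linear_diff[OF bounded_linear.linear[OF bounded_linear_sqrt_defect_approx]])

lemma norm_sqrt_defect_approx_le:
  "norm (sqrt_defect_approx X n x) \<le> sqrt_defect_majorant n * norm x"
proof (induction n arbitrary: x)
  case (Suc n)
  let ?Y = "sqrt_defect_approx X n" and ?y = "sqrt_defect_majorant n"
  have "norm (?Y (?Y x)) \<le> ?y * (?y * norm x)"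
    by (intro order.trans[OF Suc] mult_left_mono Suc sqrt_defect_majorant_nonneg)
  then have "norm (X x + ?Y (?Y x)) \<le> norm x + ?y * (?y * norm x)"
    by (intro norm_triangle_mono norm_X_le)
  then show ?case
    by (simp add: power2_eq_square algebra_simps del: scaleR_add_right)
qed simp

lemma norm_sqrt_defect_approx_le_norm: "norm (sqrt_defect_approx X n x) \<le> norm x"
  by (rule order.trans[OF norm_sqrt_defect_approx_le])
    (simp add: mult_left_le_one_le sqrt_defect_majorant_le_1 sqrt_defect_majorant_nonneg)

lemma norm_sqrt_defect_approx_increment_le:
  "norm (sqrt_defect_approx X (Suc n) x - sqrt_defect_approx X n x)
    \<le> (sqrt_defect_majorant (Suc n) - sqrt_defect_majorant n) * norm x"
proof (induction n arbitrary: x)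
  case 0
  show ?case using norm_X_le[of x] by simp
next
  case (Suc n)
  define Y where "Y = sqrt_defect_approx X n"
  define Z where "Z = sqrt_defect_approx X (Suc n)"
  define y where "y = sqrt_defect_majorant n"
  define z where "z = sqrt_defect_majorant (Suc n)"
  note folds = Y_def[symmetric] Z_def[symmetric] y_def[symmetric] z_def[symmetric]
  note IH = Suc[unfolded folds]
  have "norm (Z (Z x) - Y (Z x)) \<le> (z - y) * (z * norm x)"
    by (intro order.trans[OF IH] mult_left_mono)
      (simp_all add: Z_def z_def y_def norm_sqrt_defect_approx_le sqrt_defect_majorant_mono
        del: sqrt_defect_majorant.simps sqrt_defect_approx.simps)
  moreover have "norm (Y (Z x - Y x)) \<le> y * ((z - y) * norm x)"
    unfolding Y_def y_def
    by (intro order.trans[OF norm_sqrt_defect_approx_le] mult_left_mono IH[unfolded Y_def y_def]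
        sqrt_defect_majorant_nonneg)
  ultimately have "norm ((Z (Z x) - Y (Z x)) + Y (Z x - Y x)) / 2
      \<le> ((z - y) * (z * norm x) + y * ((z - y) * norm x)) / 2"
    by (intro divide_right_mono norm_triangle_mono) simp_all
  also have "\<dots> = (sqrt_defect_majorant (Suc (Suc n)) - z) * norm x"
    by (simp add: z_def y_def[symmetric] power2_eq_square field_simps)
  finally have "norm (((Z (Z x) - Y (Z x)) + Y (Z x - Y x)) /\<^sub>R 2)
      \<le> (sqrt_defect_majorant (Suc (Suc n)) - z) * norm x"
    by simp
  moreover have "sqrt_defect_approx X (Suc (Suc n)) x - Z x
      = ((Z (Z x) - Y (Z x)) + Y (Z x - Y x)) /\<^sub>R 2"
    by (simp add: Z_def sqrt_defect_approx_diff Y_def algebra_simps)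
  ultimately show ?case unfolding Z_def z_def by simp
qed

lemma sqrt_defect_approx_tendsto: "(\<lambda>n. sqrt_defect_approx X n x) \<longlonglongrightarrow> sqrt_defect X x"
proof -
  have "summable (\<lambda>n. sqrt_defect_majorant (Suc n) - sqrt_defect_majorant n)"
    using convergent_sqrt_defect_majorant telescope_summable unfolding convergent_def by blast
  then have "summable (\<lambda>n. sqrt_defect_approx X (Suc n) x - sqrt_defect_approx X n x)"
    by (rule summable_comparison_test'[OF summable_mult2, of _ 0 _ "norm x"])
      (rule norm_sqrt_defect_approx_increment_le)
  then have "convergent (\<lambda>n. sqrt_defect_approx X n x)"
    unfolding summable_iff_convergent sum_lessThan_telescope[of "\<lambda>n. sqrt_defect_approx X n x"]
    by simp
  then show ?thesis unfolding sqrt_defect_def by (rule convergent_LIMSEQ_iff[THEN iffD1])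
qed

lemma norm_sqrt_defect_le: "norm (sqrt_defect X x) \<le> norm x"
  by (rule tendsto_upperbound[OF tendsto_norm[OF sqrt_defect_approx_tendsto]])
    (simp_all add: norm_sqrt_defect_approx_le_norm)

lemma sqrt_defect_equation: "X x = 2 *\<^sub>R sqrt_defect X x - sqrt_defect X (sqrt_defect X x)"
proof -
  let ?Y = "sqrt_defect_approx X" and ?L = "sqrt_defect X"
  note lim = sqrt_defect_approx_tendsto
  have "(\<lambda>n. ?Y n (?Y n x) - ?Y n (?L x)) \<longlonglongrightarrow> 0"
  proof (rule Lim_null_comparison)
    show "\<forall>\<^sub>F n in sequentially. norm (?Y n (?Y n x) - ?Y n (?L x)) \<le> norm (?Y n x - ?L x)"
      by (simp add: norm_sqrt_defect_approx_le_norm flip: sqrt_defect_approx_diff)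
    show "(\<lambda>n. norm (?Y n x - ?L x)) \<longlonglongrightarrow> 0"
      using lim[of x] by (simp add: LIM_zero tendsto_norm_zero)
  qed
  from tendsto_add[OF this lim[of "?L x"]] have "(\<lambda>n. ?Y n (?Y n x)) \<longlonglongrightarrow> ?L (?L x)" by simp
  then have "(\<lambda>n. ?Y (Suc n) x) \<longlonglongrightarrow> (X x + ?L (?L x)) /\<^sub>R 2"
    unfolding sqrt_defect_approx.simps by (intro tendsto_intros)
  then have "?L x = (X x + ?L (?L x)) /\<^sub>R 2"
    by (rule LIMSEQ_unique[OF LIMSEQ_Suc[OF lim]])
  moreover have "2 *\<^sub>R ((X x + ?L (?L x)) /\<^sub>R 2) = X x + ?L (?L x)"
    by (simp del: scaleR_add_right)
  ultimately show ?thesis by (simp add: eq_diff_eq)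
qed

lemma sqrt_defect_commuting:
  assumes B: "bounded_linear B" and BX: "commuting B X" shows "commuting B (sqrt_defect X)"
proof (rule commutingI)
  fix x
  interpret B: bounded_linear B by (rule B)
  have "B (sqrt_defect_approx X n x) = sqrt_defect_approx X n (B x)" for n x
    by (induction n arbitrary: x) (simp_all add: B.zero B.scaleR B.add commutingD[OF BX])
  then have "(\<lambda>n. sqrt_defect_approx X n (B x)) \<longlonglongrightarrow> B (sqrt_defect X x)"
    using B.tendsto[OF sqrt_defect_approx_tendsto[of x]] by simp
  then show "B (sqrt_defect X x) = sqrt_defect X (B x)"
    by (rule LIMSEQ_unique[OF _ sqrt_defect_approx_tendsto])
qed

end

section \<open>Modules with a Cauchy--Schwarz inequality\<close>

lemma scaleC_one [simp]: "1 *\<^sub>C x = (x :: 'a::complex_banach)"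
  using scaleC_of_real[of 1 x] by simp

lemma scaleC_minus_one: "(- 1) *\<^sub>C x = - (x :: 'a::complex_banach)"
  using scaleC_of_real[of "- 1" x] by simp

lemma scaleC_minus_left: "(- c) *\<^sub>C x = - (c *\<^sub>C (x :: 'a::complex_banach))"
  using scaleC_scaleC[of "- 1" c x] by (simp add: scaleC_minus_one)

lemma scaleC_minus_right: "c *\<^sub>C (- x) = - (c *\<^sub>C (x :: 'a::complex_banach))"
  using scaleC_scaleC[of c "- 1" x] by (simp add: scaleC_minus_one scaleC_minus_left)

lemma scaleC_diff_left: "(c - d) *\<^sub>C x = c *\<^sub>C x - d *\<^sub>C (x :: 'a::complex_banach)"
  using scaleC_add_left[of c "- d" x] by (simp add: scaleC_minus_left)

lemma scaleC_diff_right: "c *\<^sub>C (x - y) = c *\<^sub>C x - c *\<^sub>C (y :: 'a::complex_banach)"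
  using scaleC_add_right[of c x "- y"] by (simp add: scaleC_minus_right)

lemmas scaleC_algebra = scaleC_add_left scaleC_add_right scaleC_diff_left scaleC_diff_right
  scaleC_minus_left scaleC_minus_right scaleC_scaleC

locale star_sesquilinear =
  fixes ip :: "'h::complex_banach \<Rightarrow> 'h \<Rightarrow> 'a::cstar_algebra"
  assumes ip_add_right: "ip x (y + z) = ip x y + ip x z"
    and ip_scaleC_right: "ip x (c *\<^sub>C y) = c *\<^sub>C ip x y"
    and ip_star: "ip y x = star (ip x y)"
begin

lemma ip_add_left: "ip (x + y) z = ip x z + ip y z"
  by (metis ip_add_right ip_star star_add)

lemma ip_scaleC_left: "ip (c *\<^sub>C x) y = cnj c *\<^sub>C ip x y"
  by (metis ip_scaleC_right ip_star star_scaleC)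

lemma ip_diff_left: "ip (x - y) z = ip x z - ip y z"
  using ip_add_left[of "x - y" y z] by simp

lemma ip_diff_right: "ip x (y - z) = ip x y - ip x z"
  using ip_add_right[of x "y - z" z] by simp

end

text \<open>
  Positivity of the inner product is not assumed, so that the operator theory applies both to
  Hilbert modules and to a \<open>C\<^sup>*\<close>-algebra acting on itself by left multiplication, where positivity
  of \<open>star a * a\<close> would be a theorem in its own right.
\<close>

locale cauchy_schwarz_module = star_sesquilinear ip
  for ip :: "'h::complex_banach \<Rightarrow> 'h \<Rightarrow> 'a::cstar_algebra" +
  assumes norm_ip_self: "norm (ip x x) = (norm x)\<^sup>2"
    and Cauchy_Schwarz: "norm (ip x y) \<le> norm x * norm y"
begin

sublocale ip: bounded_bilinear ip
proof
  show "\<exists>K. \<forall>x y. norm (ip x y) \<le> norm x * norm y * K"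
    using Cauchy_Schwarz by (intro exI[of _ 1]) simp
  show "ip (r *\<^sub>R x) y = r *\<^sub>R ip x y" for r x y
    by (metis complex_cnj_complex_of_real ip_scaleC_left scaleC_of_real)
  show "ip x (r *\<^sub>R y) = r *\<^sub>R ip x y" for r x y
    by (metis ip_scaleC_right scaleC_of_real)
qed (simp_all add: ip_add_left ip_add_right)

lemma ip_self_eq_zero_iff: "ip x x = 0 \<longleftrightarrow> x = 0"
  using norm_ip_self[of x] by (metis norm_eq_zero zero_eq_power2)

lemma ip_ext: "(\<And>x. ip x y = ip x z) \<Longrightarrow> y = z"
  using ip_self_eq_zero_iff[of "y - z"] by (simp add: ip_diff_right)

definition adjoint_pair :: "('h \<Rightarrow> 'h) \<Rightarrow> ('h \<Rightarrow> 'h) \<Rightarrow> bool" where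
  "adjoint_pair S S' \<longleftrightarrow> (\<forall>x y. ip (S x) y = ip x (S' y))"

lemma adjoint_pairI: "(\<And>x y. ip (S x) y = ip x (S' y)) \<Longrightarrow> adjoint_pair S S'"
  by (simp add: adjoint_pair_def)

lemma adjoint_pairD: "adjoint_pair S S' \<Longrightarrow> ip (S x) y = ip x (S' y)"
  by (simp add: adjoint_pair_def)

lemma adjoint_pair_sym: "adjoint_pair S S' \<Longrightarrow> adjoint_pair S' S"
  unfolding adjoint_pair_def by (metis ip_star)

lemma adjoint_pair_unique: "adjoint_pair S S' \<Longrightarrow> adjoint_pair S S'' \<Longrightarrow> S' = S''"
  unfolding adjoint_pair_def by (metis ext ip_ext)

lemma adjoint_pair_adj_eq: "adjoint_pair S S' \<Longrightarrow> adj ip S = S'"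
  unfolding adj_def
  by (rule the_equality) (auto simp flip: adjoint_pair_def intro: adjoint_pair_unique)

lemma adjoint_pair_adjointable: "adjoint_pair S S' \<Longrightarrow> S \<in> adjointable ip"
  by (auto simp: adjointable_def adjoint_pair_def)

lemma adjoint_pair_adj: "S \<in> adjointable ip \<Longrightarrow> adjoint_pair S (adj ip S)"
  unfolding adjointable_def using adjoint_pair_adj_eq by (auto simp: adjoint_pair_def)

lemma adj_adjointable: "S \<in> adjointable ip \<Longrightarrow> adj ip S \<in> adjointable ip"
  by (rule adjoint_pair_adjointable[OF adjoint_pair_sym[OF adjoint_pair_adj]])

lemma adj_adj: "S \<in> adjointable ip \<Longrightarrow> adj ip (adj ip S) = S"
  by (rule adjoint_pair_adj_eq[OF adjoint_pair_sym[OF adjoint_pair_adj]])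

lemma adjoint_pair_id: "adjoint_pair (\<lambda>x. x) (\<lambda>x. x)"
  by (simp add: adjoint_pair_def)

lemma adjoint_pair_comp:
  "adjoint_pair A A' \<Longrightarrow> adjoint_pair B B' \<Longrightarrow> adjoint_pair (\<lambda>x. A (B x)) (\<lambda>x. B' (A' x))"
  by (simp add: adjoint_pair_def)

lemma adjoint_pair_funpow: "adjoint_pair A A' \<Longrightarrow> adjoint_pair (A ^^ n) (A' ^^ n)"
  by (induction n) (simp_all add: adjoint_pair_def funpow_swap1)

lemma adj_funpow: "S \<in> adjointable ip \<Longrightarrow> adj ip (S ^^ n) = adj ip S ^^ n"
  by (rule adjoint_pair_adj_eq[OF adjoint_pair_funpow[OF adjoint_pair_adj]])

lemma adjoint_pair_add:
  "adjoint_pair A A' \<Longrightarrow> adjoint_pair B B' \<Longrightarrow> adjoint_pair (\<lambda>x. A x + B x) (\<lambda>x. A' x + B' x)"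
  by (simp add: adjoint_pair_def ip_add_left ip_add_right)

lemma adjoint_pair_diff:
  "adjoint_pair A A' \<Longrightarrow> adjoint_pair B B' \<Longrightarrow> adjoint_pair (\<lambda>x. A x - B x) (\<lambda>x. A' x - B' x)"
  by (simp add: adjoint_pair_def ip_diff_left ip_diff_right)

lemma adjoint_pair_scaleC: "adjoint_pair A A' \<Longrightarrow> adjoint_pair (\<lambda>x. c *\<^sub>C A x) (\<lambda>x. cnj c *\<^sub>C A' x)"
  by (simp add: adjoint_pair_def ip_scaleC_left ip_scaleC_right)

lemma adjoint_pair_scaleR: "adjoint_pair A A' \<Longrightarrow> adjoint_pair (\<lambda>x. r *\<^sub>R A x) (\<lambda>x. r *\<^sub>R A' x)"
  by (simp add: adjoint_pair_def ip.scaleR_left ip.scaleR_right)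

lemma adjoint_pair_homogeneous:
  assumes "adjoint_pair S S'" shows "S (c *\<^sub>C x) = c *\<^sub>C S x"
  by (rule ip_ext)
    (simp add: adjoint_pairD[OF adjoint_pair_sym[OF assms], symmetric] ip_scaleC_right)

lemma adjoint_pair_bounded_linear:
  assumes S: "adjoint_pair S S'" shows "bounded_linear S"
proof -
  note S_right = adjoint_pairD[OF adjoint_pair_sym[OF S], symmetric]
  have "bounded_linear (\<lambda>x. ip (S y) x /\<^sub>R norm y)" for y
    by (intro bounded_linear_scaleR_right[THEN bounded_linear_compose] ip.bounded_linear_right)
  moreover have "\<exists>C. \<forall>y. norm (ip (S y) x /\<^sub>R norm y) \<le> C" for x
  proof (intro exI allI)
    show "norm (ip (S y) x /\<^sub>R norm y) \<le> norm (S' x)" for y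
      using Cauchy_Schwarz[of y "S' x"]
      by (cases "y = 0") (simp_all add: adjoint_pairD[OF S] field_simps)
  qed
  ultimately obtain K where K: "\<And>y x. norm (ip (S y) x /\<^sub>R norm y) \<le> K * norm x"
    using uniform_boundedness[of "\<lambda>y x. ip (S y) x /\<^sub>R norm y"] by blast
  show ?thesis
  proof (rule bounded_linear_intro)
    show "S (x + y) = S x + S y" for x y
      by (rule ip_ext) (simp add: S_right ip_add_right)
    show "S (r *\<^sub>R x) = r *\<^sub>R S x" for r x
      by (rule ip_ext) (simp add: S_right ip.scaleR_right)
    show "norm (S x) \<le> norm x * K" for x
    proof (cases "x = 0 \<or> S x = 0")
      case True
      have "S 0 = 0" using S_right by (intro ip_ext) (simp add: ip.zero_right)
      then show ?thesis
        using True K[of x x] by (auto simp: mult.commute ip.zero_left)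
    next
      case False
      then show ?thesis
        using K[of x "S x"] by (simp add: norm_ip_self power2_eq_square field_simps)
    qed
  qed
qed

lemma adjoint_pair_zero: "adjoint_pair S S' \<Longrightarrow> S 0 = 0"
  by (rule linear_0[OF bounded_linear.linear[OF adjoint_pair_bounded_linear]])

lemma adjoint_pair_linear_diff: "adjoint_pair S S' \<Longrightarrow> S (x - y) = S x - S y"
  by (rule linear_diff[OF bounded_linear.linear[OF adjoint_pair_bounded_linear]])

lemma adjoint_pair_norm_le:
  assumes S: "adjoint_pair S S'" and N: "0 \<le> N" "norm (S' (S x)) \<le> N * norm x"
  shows "norm (S x) \<le> sqrt N * norm x"
proof (rule power2_le_imp_le)
  have "(norm (S x))\<^sup>2 \<le> norm x * norm (S' (S x))"
    using Cauchy_Schwarz[of x "S' (S x)"] by (simp add: adjoint_pairD[OF S] flip: norm_ip_self)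
  also have "\<dots> \<le> norm x * (N * norm x)" by (intro mult_left_mono N) simp
  finally show "(norm (S x))\<^sup>2 \<le> (sqrt N * norm x)\<^sup>2"
    using N(1) by (simp add: power_mult_distrib) (simp add: power2_eq_square mult_ac)
qed (use N in simp)

definition selfadjoint :: "('h \<Rightarrow> 'h) \<Rightarrow> bool" where
  "selfadjoint S \<longleftrightarrow> adjoint_pair S S"

lemma selfadjointD: "selfadjoint S \<Longrightarrow> adjoint_pair S S"
  by (simp add: selfadjoint_def)

lemma selfadjoint_iff_adj: "selfadjoint S \<longleftrightarrow> S \<in> adjointable ip \<and> adj ip S = S"
  unfolding selfadjoint_def
  using adjoint_pair_adj adjoint_pair_adj_eq adjoint_pair_adjointable by metis

lemma selfadjoint_bounded_linear: "selfadjoint S \<Longrightarrow> bounded_linear S"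
  by (rule adjoint_pair_bounded_linear[OF selfadjointD])

lemma selfadjoint_obtain_bound:
  assumes "selfadjoint S"
  obtains K where "k \<le> K" "\<And>x. norm (S x) \<le> K * norm x"
proof -
  obtain K where K: "\<And>x. norm (S x) \<le> norm x * K"
    using bounded_linear.bounded[OF selfadjoint_bounded_linear[OF assms]] by blast
  have "norm (S x) \<le> max k K * norm x" for x
    using order.trans[OF K[of x] mult_left_mono[of K "max k K"]] by (simp add: mult.commute)
  then show ?thesis using that[of "max k K"] by simp
qed

lemma selfadjoint_id: "selfadjoint (\<lambda>x. x)"
  by (simp add: selfadjoint_def adjoint_pair_id)

lemma selfadjoint_add: "selfadjoint A \<Longrightarrow> selfadjoint B \<Longrightarrow> selfadjoint (\<lambda>x. A x + B x)"
  by (simp add: selfadjoint_def adjoint_pair_add)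

lemma selfadjoint_diff: "selfadjoint A \<Longrightarrow> selfadjoint B \<Longrightarrow> selfadjoint (\<lambda>x. A x - B x)"
  by (simp add: selfadjoint_def adjoint_pair_diff)

lemma selfadjoint_scaleR: "selfadjoint A \<Longrightarrow> selfadjoint (\<lambda>x. r *\<^sub>R A x)"
  by (simp add: selfadjoint_def adjoint_pair_scaleR)

lemma selfadjoint_comp:
  "selfadjoint A \<Longrightarrow> selfadjoint B \<Longrightarrow> commuting A B \<Longrightarrow> selfadjoint (\<lambda>x. A (B x))"
  using adjoint_pair_comp[of A A B B] by (simp add: selfadjoint_def commuting_def)

lemmas selfadjoint_intros = selfadjoint_id selfadjoint_add selfadjoint_diff selfadjoint_scaleR

lemma selfadjoint_inverse:
  assumes B: "selfadjoint B" and R: "\<And>x. B (R x) = x" shows "selfadjoint R"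
  unfolding selfadjoint_def
proof (rule adjoint_pairI)
  show "ip (R x) y = ip x (R y)" for x y
    using adjoint_pairD[OF selfadjointD[OF B], of "R x" "R y"] by (simp add: R)
qed

lemma selfadjoint_square_eq_zero:
  assumes S: "selfadjoint S" and zero: "\<And>x. S (S x) = 0" shows "S x = 0"
  using adjoint_pair_norm_le[OF selfadjointD[OF S], of 0 x] by (simp add: zero)

text \<open>The operator \<open>S = C + \<i> W\<close> satisfies \<open>S\<^sup>* S = S S\<^sup>* = N\<close> and \<open>2 C = S + S\<^sup>*\<close>.\<close>

lemma norm_le_of_sum_of_squares:
  assumes C: "selfadjoint C" and W: "selfadjoint W" and CW: "commuting C W"
    and N: "0 \<le> N" and sum: "\<And>x. C (C x) + W (W x) = N *\<^sub>R x"
  shows "norm (C x) \<le> sqrt N * norm x"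
proof -
  interpret C: bounded_linear C using C by (rule selfadjoint_bounded_linear)
  interpret W: bounded_linear W using W by (rule selfadjoint_bounded_linear)
  define S where "S c = (\<lambda>x. C x + c *\<^sub>C W x)" for c
  have pair: "adjoint_pair (S c) (S (cnj c))" for c
    unfolding S_def by (intro adjoint_pair_add adjoint_pair_scaleC selfadjointD C W)
  have S_adj_S: "S (cnj c) (S c x) = N *\<^sub>R x" if "cnj c * c = 1" "cnj c = - c" for c x
  proof -
    have "S (cnj c) (S c x) = C (C x) + (cnj c * c) *\<^sub>C W (W x)"
      using that(2) adjoint_pair_homogeneous[OF selfadjointD[OF C]]
        adjoint_pair_homogeneous[OF selfadjointD[OF W]]
      by (simp add: S_def C.add W.add scaleC_algebra commutingD[OF CW])
    then show ?thesis by (simp add: that(1) sum)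
  qed
  have "norm (S c x) \<le> sqrt N * norm x" if "cnj c * c = 1" "cnj c = - c" for c x
    using N by (intro adjoint_pair_norm_le[OF pair]) (simp_all only: S_adj_S[OF that], simp)
  then have "norm (S \<i> x + S (- \<i>) x) \<le> sqrt N * norm x + sqrt N * norm x"
    by (intro norm_triangle_mono) simp_all
  moreover have "S \<i> x + S (- \<i>) x = 2 *\<^sub>R C x" by (simp add: S_def scaleC_minus_left scaleR_2)
  ultimately show ?thesis by simp
qed

section \<open>Positive operators\<close>

text \<open>The norm condition is equivalent to a nonnegative spectrum, see \<open>op_positive_iff\<close> below.\<close>

definition positive_op :: "('h \<Rightarrow> 'h) \<Rightarrow> bool" where
  "positive_op R \<longleftrightarrow> selfadjoint R \<and> (\<exists>M\<ge>0. \<forall>x. norm (M *\<^sub>R x - R x) \<le> M * norm x)"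

lemma positive_opI:
  "selfadjoint R \<Longrightarrow> 0 \<le> M \<Longrightarrow> (\<And>x. norm (M *\<^sub>R x - R x) \<le> M * norm x) \<Longrightarrow> positive_op R"
  by (auto simp: positive_op_def)

lemma positive_op_selfadjoint: "positive_op R \<Longrightarrow> selfadjoint R"
  by (simp add: positive_op_def)

lemma positive_op_bounded_linear: "positive_op R \<Longrightarrow> bounded_linear R"
  by (rule selfadjoint_bounded_linear[OF positive_op_selfadjoint])

lemma positive_op_obtain_bound:
  assumes "positive_op R"
  obtains M where "M > 0" "\<And>x. norm (M *\<^sub>R x - R x) \<le> M * norm x"
proof -
  obtain M where M: "M \<ge> 0" "\<And>x. norm (M *\<^sub>R x - R x) \<le> M * norm x"
    using assms by (auto simp: positive_op_def)
  have "norm ((M + 1) *\<^sub>R x - R x) \<le> (M + 1) * norm x" for x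
    using norm_triangle_ineq[of "M *\<^sub>R x - R x" x] M(2)[of x] by (simp add: algebra_simps)
  then show ?thesis using M(1) by (intro that[of "M + 1"]) auto
qed

lemma positive_op_id: "positive_op (\<lambda>x. x)"
  by (rule positive_opI[of _ 1]) (simp_all add: selfadjoint_id)

lemma positive_op_add:
  assumes R: "positive_op R" and Q: "positive_op Q" shows "positive_op (\<lambda>x. R x + Q x)"
proof -
  obtain M where M: "M > 0" "\<And>x. norm (M *\<^sub>R x - R x) \<le> M * norm x"
    using positive_op_obtain_bound[OF R] by blast
  obtain N where N: "N > 0" "\<And>x. norm (N *\<^sub>R x - Q x) \<le> N * norm x"
    using positive_op_obtain_bound[OF Q] by blast
  show ?thesis
  proof (rule positive_opI)
    show "norm ((M + N) *\<^sub>R x - (R x + Q x)) \<le> (M + N) * norm x" for x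
      using norm_triangle_mono[OF M(2)[of x] N(2)[of x]] by (simp add: algebra_simps)
  qed (use M N R Q in \<open>simp_all add: positive_op_selfadjoint selfadjoint_add\<close>)
qed

lemma selfadjoint_sqrt_defect:
  assumes X: "selfadjoint X" "\<And>x. norm (X x) \<le> norm x"
  shows "selfadjoint (sqrt_defect X)"
  unfolding selfadjoint_def
proof (rule adjoint_pairI)
  fix x y
  note lim = sqrt_defect_approx_tendsto[OF selfadjoint_bounded_linear[OF X(1)] X(2)]
  have "selfadjoint (sqrt_defect_approx X n)" for n
  proof (induction n)
    case (Suc n)
    then show ?case
      using X(1)
      by (simp add: selfadjoint_intros selfadjoint_comp commuting_refl del: scaleR_add_right)
  qed (simp add: selfadjoint_def adjoint_pair_def ip.zero_left ip.zero_right)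
  then have "ip (sqrt_defect_approx X n x) y = ip x (sqrt_defect_approx X n y)" for n
    by (simp add: selfadjoint_def adjoint_pairD)
  moreover have "(\<lambda>n. ip (sqrt_defect_approx X n x) y) \<longlonglongrightarrow> ip (sqrt_defect X x) y"
    "(\<lambda>n. ip x (sqrt_defect_approx X n y)) \<longlonglongrightarrow> ip x (sqrt_defect X y)"
    by (intro ip.tendsto lim tendsto_const)+
  ultimately show "ip (sqrt_defect X x) y = ip x (sqrt_defect X y)"
    by (auto intro: LIMSEQ_unique)
qed

lemma positive_op_obtain_contraction:
  assumes R: "positive_op R"
  obtains M where "M > 0" "selfadjoint (\<lambda>x. x - R x /\<^sub>R M)" "\<And>x. norm (x - R x /\<^sub>R M) \<le> norm x"
proof -
  obtain M where M: "M > 0" "\<And>x. norm (M *\<^sub>R x - R x) \<le> M * norm x"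
    using positive_op_obtain_bound[OF R] by blast
  have "norm (x - R x /\<^sub>R M) \<le> norm x" for x
  proof -
    have "M *\<^sub>R (x - R x /\<^sub>R M) = M *\<^sub>R x - R x" using M(1) by (simp add: scaleR_diff_right)
    then have "norm (M *\<^sub>R (x - R x /\<^sub>R M)) \<le> M * norm x" using M(2)[of x] by simp
    then show ?thesis using M(1) by simp
  qed
  moreover have "selfadjoint (\<lambda>x. x - R x /\<^sub>R M)"
    by (intro selfadjoint_intros positive_op_selfadjoint[OF R])
  ultimately show ?thesis using that M(1) by blast
qed

lemma positive_op_sqrt_exists:
  assumes R: "positive_op R"
  obtains C where "positive_op C" "\<And>x. C (C x) = R x"
    "\<And>B. bounded_linear B \<Longrightarrow> commuting B R \<Longrightarrow> commuting B C"
proof -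
  obtain M where M: "M > 0" "selfadjoint (\<lambda>x. x - R x /\<^sub>R M)" "\<And>x. norm (x - R x /\<^sub>R M) \<le> norm x"
    using positive_op_obtain_contraction[OF R] by blast
  define X where "X = (\<lambda>x. x - R x /\<^sub>R M)"
  have X: "selfadjoint X" "\<And>x. norm (X x) \<le> norm x" using M(2,3) by (simp_all add: X_def)
  note contraction = selfadjoint_bounded_linear[OF X(1)] X(2)
  define Y where "Y = sqrt_defect X"
  have Y: "selfadjoint Y" unfolding Y_def by (rule selfadjoint_sqrt_defect[OF X])
  interpret Y: bounded_linear Y by (rule selfadjoint_bounded_linear[OF Y])
  define C where "C = (\<lambda>x. sqrt M *\<^sub>R (x - Y x))"
  show ?thesis
  proof (rule that[of C])
    show "positive_op C"
    proof (rule positive_opI)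
      show "selfadjoint C" unfolding C_def by (intro selfadjoint_intros Y)
      show "norm (sqrt M *\<^sub>R x - C x) \<le> sqrt M * norm x" for x
        using norm_sqrt_defect_le[OF contraction, of x] M(1)
        by (simp add: C_def Y_def scaleR_diff_right)
    qed (use M in simp)
    show "C (C x) = R x" for x
    proof -
      have "C (C x) = M *\<^sub>R (x - (2 *\<^sub>R Y x - Y (Y x)))"
        using M(1) by (simp add: C_def Y.scaleR Y.diff scaleR_2 algebra_simps)
      also have "\<dots> = M *\<^sub>R (x - X x)"
        unfolding Y_def by (simp flip: sqrt_defect_equation[OF contraction])
      also have "\<dots> = R x" using M(1) by (simp add: X_def)
      finally show ?thesis .
    qed
    fix B :: "'h \<Rightarrow> 'h"
    assume B: "bounded_linear B" "commuting B R"
    interpret B: bounded_linear B by (rule B)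
    have "commuting B X" by (simp add: commuting_def X_def B.diff B.scaleR commutingD[OF B(2)])
    then have "commuting B Y" unfolding Y_def by (rule sqrt_defect_commuting[OF contraction B(1)])
    then show "commuting B C" by (simp add: commuting_def C_def B.scaleR B.diff)
  qed
qed

lemma selfadjoint_complementary_square:
  assumes C: "selfadjoint C" and K: "0 \<le> K" "\<And>x. norm (C x) \<le> K * norm x"
  obtains W where "selfadjoint W" "\<And>x. C (C x) + W (W x) = K\<^sup>2 *\<^sub>R x"
    "\<And>B. bounded_linear B \<Longrightarrow> commuting B C \<Longrightarrow> commuting B W"
proof -
  define R where "R = (\<lambda>x. K\<^sup>2 *\<^sub>R x - C (C x))"
  have "positive_op R"
  proof (rule positive_opI)
    show "selfadjoint R"
      unfolding R_def by (intro selfadjoint_intros selfadjoint_comp[OF C C commuting_refl])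
    show "norm (K\<^sup>2 *\<^sub>R x - R x) \<le> K\<^sup>2 * norm x" for x
      using order.trans[OF K(2)[of "C x"] mult_left_mono[OF K(2)[of x] K(1)]]
      by (simp add: R_def power2_eq_square mult.assoc)
  qed simp
  then obtain W where W: "positive_op W" "\<And>x. W (W x) = R x"
    "\<And>B. bounded_linear B \<Longrightarrow> commuting B R \<Longrightarrow> commuting B W"
    using positive_op_sqrt_exists by blast
  show ?thesis
  proof (rule that[of W])
    show "selfadjoint W" using W(1) by (rule positive_op_selfadjoint)
    show "C (C x) + W (W x) = K\<^sup>2 *\<^sub>R x" for x by (simp add: W(2) R_def)
    fix B :: "'h \<Rightarrow> 'h"
    assume B: "bounded_linear B" "commuting B C"
    interpret B: bounded_linear B by (rule B)
    have "commuting B R" by (rule commutingI) (simp add: R_def B.diff B.scaleR commutingD[OF B(2)])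
    then show "commuting B W" by (rule W(3)[OF B(1)])
  qed
qed

lemma positive_op_square:
  assumes C: "selfadjoint C" shows "positive_op (\<lambda>x. C (C x))"
proof -
  obtain K where K: "0 \<le> K" "\<And>x. norm (C x) \<le> K * norm x"
    using selfadjoint_obtain_bound[OF C, of 0] by blast
  obtain W where W: "selfadjoint W" "\<And>x. C (C x) + W (W x) = K\<^sup>2 *\<^sub>R x"
    "\<And>B. bounded_linear B \<Longrightarrow> commuting B C \<Longrightarrow> commuting B W"
    using selfadjoint_complementary_square[OF C K] by blast
  have "commuting C W" by (rule W(3)[OF selfadjoint_bounded_linear[OF C] commuting_refl])
  from norm_le_of_sum_of_squares[OF W(1) C commuting_sym[OF this], of "K\<^sup>2"]
  have W_le: "norm (W x) \<le> K * norm x" for x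
    using K(1) by (simp add: W(2) add.commute[of "W (W _)"])
  show ?thesis
  proof (rule positive_opI)
    show "selfadjoint (\<lambda>x. C (C x))" by (rule selfadjoint_comp[OF C C commuting_refl])
    fix x
    have "K\<^sup>2 *\<^sub>R x - C (C x) = W (W x)" by (simp flip: W(2)[of x])
    also have "norm \<dots> \<le> K * (K * norm x)"
      by (intro order.trans[OF W_le] mult_left_mono W_le K)
    finally show "norm (K\<^sup>2 *\<^sub>R x - C (C x)) \<le> K\<^sup>2 * norm x"
      by (simp add: power2_eq_square mult.assoc)
  qed simp
qed

lemma positive_op_comp:
  assumes R: "positive_op R" and Q: "positive_op Q" and RQ: "commuting R Q"
  shows "positive_op (\<lambda>x. R (Q x))"
proof -
  obtain C where C: "positive_op C" "\<And>x. C (C x) = R x"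
    "\<And>B. bounded_linear B \<Longrightarrow> commuting B R \<Longrightarrow> commuting B C"
    using positive_op_sqrt_exists[OF R] by blast
  obtain D where D: "positive_op D" "\<And>x. D (D x) = Q x"
    "\<And>B. bounded_linear B \<Longrightarrow> commuting B Q \<Longrightarrow> commuting B D"
    using positive_op_sqrt_exists[OF Q] by blast
  have "commuting Q C" by (rule C(3)[OF positive_op_bounded_linear[OF Q] commuting_sym[OF RQ]])
  then have CD: "commuting C D"
    by (rule D(3)[OF positive_op_bounded_linear[OF C(1)] commuting_sym])
  note selfadjoint_CD = C(1)[THEN positive_op_selfadjoint] D(1)[THEN positive_op_selfadjoint]
  have "positive_op (\<lambda>x. C (D (C (D x))))"
    by (rule positive_op_square[OF selfadjoint_comp[OF selfadjoint_CD CD]])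
  then show ?thesis by (simp add: C(2) D(2) flip: commutingD[OF CD])
qed

lemma positive_op_norm_mono:
  assumes Z: "positive_op Z" and W: "positive_op W"
    and N: "0 \<le> N" "\<And>x. norm (Z x + W x) \<le> N * norm x"
  shows "norm (Z x) \<le> N * norm x"
proof -
  have "positive_op (\<lambda>x. N *\<^sub>R x - (Z x + W x))"
    using N(2) Z[THEN positive_op_selfadjoint] W[THEN positive_op_selfadjoint]
    by (intro positive_opI[OF _ N(1)] selfadjoint_intros) (simp_all add: add.commute)
  from positive_op_add[OF this W] have "positive_op (\<lambda>x. N *\<^sub>R x - Z x)"
    by (simp add: algebra_simps)
  then obtain E where E: "positive_op E" "\<And>x. E (E x) = N *\<^sub>R x - Z x"
    "\<And>B. bounded_linear B \<Longrightarrow> commuting B (\<lambda>x. N *\<^sub>R x - Z x) \<Longrightarrow> commuting B E"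
    using positive_op_sqrt_exists by blast
  obtain C where C: "positive_op C" "\<And>x. C (C x) = Z x"
    by (rule positive_op_sqrt_exists[OF Z]) (rule that)
  interpret C: bounded_linear C by (rule positive_op_bounded_linear[OF C(1)])
  have "commuting C (\<lambda>x. N *\<^sub>R x - Z x)"
    by (rule commutingI) (simp add: C.diff C.scaleR flip: C(2))
  then have "commuting C E" by (rule E(3)[OF C.bounded_linear_axioms])
  then have C_le: "norm (C x) \<le> sqrt N * norm x" for x
    by (rule norm_le_of_sum_of_squares[OF C(1)[THEN positive_op_selfadjoint]
          E(1)[THEN positive_op_selfadjoint] _ N(1)])
      (simp add: C(2) E(2))
  have "norm (C (C x)) \<le> sqrt N * (sqrt N * norm x)"
    by (intro order.trans[OF C_le] mult_left_mono C_le) (simp add: N(1))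
  then show ?thesis using N(1) by (simp add: C(2) flip: mult.assoc)
qed

lemma positive_op_antisym:
  assumes "positive_op Z" "positive_op (\<lambda>x. - Z x)" shows "Z x = 0"
  using positive_op_norm_mono[OF assms, where N = 0 and x = x] by simp

lemma commuting_positive_op_sqrt_unique:
  assumes R: "positive_op R" and C: "positive_op C" and RC: "commuting R C"
    and square: "\<And>x. R (R x) = C (C x)"
  shows "R = C"
proof -
  interpret R: bounded_linear R by (rule positive_op_bounded_linear[OF R])
  interpret C: bounded_linear C by (rule positive_op_bounded_linear[OF C])
  define D where "D = (\<lambda>x. R x - C x)"
  have D: "selfadjoint D"
    unfolding D_def by (intro selfadjoint_intros positive_op_selfadjoint R C)
  have RD: "commuting R D" and CD: "commuting C D"
    by (simp_all add: commuting_def D_def R.diff C.diff commutingD[OF RC])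
  have "R (D x) + C (D x) = 0" for x
    by (simp add: D_def R.diff C.diff square commutingD[OF RC])
  then have CDD: "C (D (D x)) = - R (D (D x))" for x by (simp add: add_eq_0_iff)
  have "positive_op (\<lambda>x. R (D (D x)))"
    by (rule positive_op_comp[OF R positive_op_square[OF D] commuting_comp[OF RD RD]])
  moreover have "positive_op (\<lambda>x. C (D (D x)))"
    by (rule positive_op_comp[OF C positive_op_square[OF D] commuting_comp[OF CD CD]])
  ultimately have RDD: "R (D (D x)) = 0" for x
    unfolding CDD by (rule positive_op_antisym)
  moreover have "D y = R y - C y" for y by (simp add: D_def)
  ultimately have "D (D (D x)) = 0" for x by (metis CDD diff_0_right minus_zero)
  then have "D (D x) = 0" for x
    using adjoint_pair_zero[OF selfadjointD[OF D]]
    by (intro selfadjoint_square_eq_zero[OF selfadjoint_comp[OF D D commuting_refl], of x]) simp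
  then have "D x = 0" for x by (rule selfadjoint_square_eq_zero[OF D])
  then show ?thesis by (auto simp: D_def)
qed

lemma positive_op_sqrt_unique:
  assumes R: "positive_op R" and Q: "positive_op Q" and square: "\<And>x. R (R x) = Q (Q x)"
  shows "R = Q"
proof -
  obtain C where C: "positive_op C" "\<And>x. C (C x) = R (R x)"
    "\<And>B. bounded_linear B \<Longrightarrow> commuting B (\<lambda>x. R (R x)) \<Longrightarrow> commuting B C"
    using positive_op_sqrt_exists[OF positive_op_square[OF positive_op_selfadjoint[OF R]]] by blast
  have "S = C" if S: "positive_op S" "\<And>x. S (S x) = R (R x)" for S
  proof (rule commuting_positive_op_sqrt_unique[OF S(1) C(1)])
    have "commuting S (\<lambda>x. R (R x))" by (simp add: commuting_def flip: S(2))
    then show "commuting S C" by (rule C(3)[OF positive_op_bounded_linear[OF S(1)]])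
  qed (simp add: C(2) S(2))
  then show ?thesis using R Q square by metis
qed

section \<open>Spectrum\<close>

definition invertible_op :: "('h \<Rightarrow> 'h) \<Rightarrow> bool" where
  "invertible_op B \<longleftrightarrow> (\<exists>R\<in>adjointable ip. B \<circ> R = id \<and> R \<circ> B = id)"

lemma op_spectrum_eq: "op_spectrum ip T = {c. \<not> invertible_op (\<lambda>x. c *\<^sub>C x - T x)}"
  by (simp add: op_spectrum_def invertible_op_def)

lemma invertible_opI:
  assumes "adjoint_pair R R'" "\<And>x. B (R x) = x" "\<And>x. R (B x) = x" shows "invertible_op B"
  unfolding invertible_op_def
  by (rule bexI[OF _ adjoint_pair_adjointable[OF assms(1)]]) (simp add: fun_eq_iff assms)

lemma invertible_op_obtain:
  assumes "invertible_op B"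
  obtains R R' where "adjoint_pair R R'" "\<And>x. B (R x) = x" "\<And>x. R (B x) = x"
  using assms adjoint_pair_adj unfolding invertible_op_def by (metis comp_apply id_apply)

lemma invertible_op_comp:
  assumes A: "invertible_op A" and B: "invertible_op B" shows "invertible_op (\<lambda>x. A (B x))"
proof -
  obtain R R' where R: "adjoint_pair R R'" "\<And>x. A (R x) = x" "\<And>x. R (A x) = x"
    using invertible_op_obtain[OF A] by blast
  obtain S S' where S: "adjoint_pair S S'" "\<And>x. B (S x) = x" "\<And>x. S (B x) = x"
    using invertible_op_obtain[OF B] by blast
  show ?thesis by (rule invertible_opI[OF adjoint_pair_comp[OF S(1) R(1)]]) (simp_all add: R S)
qed

lemma invertible_op_of_comp:
  assumes B: "adjoint_pair B B'" and AB: "commuting A B" and inv: "invertible_op (\<lambda>x. A (B x))"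
  shows "invertible_op A"
proof -
  obtain R R' where R: "adjoint_pair R R'" "\<And>x. A (B (R x)) = x" "\<And>x. R (A (B x)) = x"
    using invertible_op_obtain[OF inv] by blast
  have "R (B y) = B (R y)" for y
    using R(3)[of "B (R y)"] R(2)[of y] commutingD[OF AB] by metis
  then have "B (R (A x)) = x" for x
    using R(3)[of x] by (simp add: commutingD[OF AB])
  then show ?thesis by (intro invertible_opI[OF adjoint_pair_comp[OF B R(1)]]) (simp_all add: R)
qed

lemma invertible_op_minus_iff: "invertible_op (\<lambda>x. - B x) \<longleftrightarrow> invertible_op B"
proof -
  have "invertible_op (\<lambda>x. - C x)" if "invertible_op C" for C
  proof -
    have "invertible_op (\<lambda>x. (-1) *\<^sub>R x)"
      by (rule invertible_opI[OF adjoint_pair_scaleR[OF adjoint_pair_id, of "- 1"]]) simp_all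
    from invertible_op_comp[OF this that] show ?thesis by simp
  qed
  from this[of B] this[of "\<lambda>x. - B x"] show ?thesis by auto
qed

lemma selfadjoint_obtain_inverse:
  assumes B: "selfadjoint B" and inv: "invertible_op B"
  obtains R where "selfadjoint R" "\<And>x. B (R x) = x" "\<And>x. R (B x) = x"
proof -
  obtain R R' where R: "adjoint_pair R R'" "\<And>x. B (R x) = x" "\<And>x. R (B x) = x"
    using invertible_op_obtain[OF inv] by blast
  from selfadjoint_inverse[OF B R(2)] show ?thesis by (rule that[OF _ R(2,3)])
qed

lemma selfadjoint_bij_invertible_op:
  assumes B: "selfadjoint B" and "bij B" shows "invertible_op B"
proof -
  have inv: "B (inv B x) = x" "inv B (B x) = x" for x
    using \<open>bij B\<close> by (simp_all add: bij_is_surj surj_f_inv_f bij_is_inj)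
  from selfadjointD[OF selfadjoint_inverse[OF B inv(1)]] show ?thesis
    by (rule invertible_opI) (simp_all add: inv)
qed

lemma invertible_op_scaleR_diff:
  assumes B: "selfadjoint B" and q: "0 \<le> q" "q < r" "\<And>x. norm (B x) \<le> q * norm x"
  shows "invertible_op (\<lambda>x. r *\<^sub>R x - B x)"
proof (rule selfadjoint_bij_invertible_op)
  show "selfadjoint (\<lambda>x. r *\<^sub>R x - B x)" by (intro selfadjoint_intros B)
  show "bij (\<lambda>x. r *\<^sub>R x - B x)"
    by (rule bij_scaleR_diff[OF bounded_linear.linear[OF selfadjoint_bounded_linear[OF B]] q])
qed

lemma positive_op_invertible_shift:
  assumes R: "positive_op R" and s: "s > 0" shows "invertible_op (\<lambda>x. s *\<^sub>R x + R x)"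
proof -
  obtain M where M: "M > 0" "\<And>x. norm (M *\<^sub>R x - R x) \<le> M * norm x"
    using positive_op_obtain_bound[OF R] by blast
  have "selfadjoint (\<lambda>x. M *\<^sub>R x - R x)" by (intro selfadjoint_intros positive_op_selfadjoint[OF R])
  from invertible_op_scaleR_diff[OF this _ _ M(2), of "s + M"] show ?thesis
    using M(1) s by (simp add: algebra_simps)
qed

text \<open>The product of \<open>c - B\<close> and \<open>cnj c - B\<close> is \<open>(Im c)\<^sup>2 + (B - Re c)\<^sup>2\<close>.\<close>

lemma selfadjoint_invertible_nonreal_shift:
  assumes B: "selfadjoint B" and c: "Im c \<noteq> 0" shows "invertible_op (\<lambda>x. c *\<^sub>C x - B x)"
proof (rule invertible_op_of_comp)
  interpret B: bounded_linear B by (rule selfadjoint_bounded_linear[OF B])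
  define D where "D = (\<lambda>x. B x - Re c *\<^sub>R x)"
  have D: "selfadjoint D" unfolding D_def by (intro selfadjoint_intros B)
  interpret D: bounded_linear D by (rule selfadjoint_bounded_linear[OF D])
  have shift: "z *\<^sub>C x - B x = (z - of_real (Re c)) *\<^sub>C x - D x" for z x
    by (simp add: D_def scaleC_diff_left scaleC_of_real)
  have "c - of_real (Re c) = \<i> * of_real (Im c)" "cnj c - of_real (Re c) = - (\<i> * of_real (Im c))"
    by (simp_all add: complex_eq_iff)
  note shift_c = shift[of c, unfolded this] shift[of "cnj c", unfolded this]
  note D_scaleC = adjoint_pair_homogeneous[OF selfadjointD[OF D]]
  have square: "- ((\<i> * of_real r) *\<^sub>C ((\<i> * of_real r) *\<^sub>C x)) = r\<^sup>2 *\<^sub>R x" for r and x :: 'h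
  proof -
    have "(\<i> * of_real r) * (\<i> * of_real r) = - complex_of_real (r\<^sup>2)"
      by (simp add: complex_eq_iff power2_eq_square)
    then show ?thesis by (simp only: scaleC_scaleC scaleC_minus_left scaleC_of_real) simp
  qed
  show "adjoint_pair (\<lambda>x. cnj c *\<^sub>C x - B x) (\<lambda>x. c *\<^sub>C x - B x)"
    using adjoint_pair_diff[OF adjoint_pair_scaleC[OF adjoint_pair_id, of "cnj c"]
        selfadjointD[OF B]]
    by simp
  show "commuting (\<lambda>x. c *\<^sub>C x - B x) (\<lambda>x. cnj c *\<^sub>C x - B x)"
    unfolding shift_c
    by (rule commutingI) (simp add: D.diff D.neg D_scaleC scaleC_algebra)
  have "c *\<^sub>C (cnj c *\<^sub>C x - B x) - B (cnj c *\<^sub>C x - B x) = (Im c)\<^sup>2 *\<^sub>R x + D (D x)" for x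
    unfolding shift_c square[symmetric]
    by (simp add: D.diff D.neg D_scaleC scaleC_diff_right scaleC_minus_left scaleC_minus_right)
  then show "invertible_op (\<lambda>x. c *\<^sub>C (cnj c *\<^sub>C x - B x) - B (cnj c *\<^sub>C x - B x))"
    using positive_op_invertible_shift[OF positive_op_square[OF D]] c by simp
qed

lemma selfadjoint_inverse_complementary_square:
  assumes W: "selfadjoint W" "invertible_op W" and k: "k > 0"
  obtains L V where "k \<le> L" "selfadjoint V" "\<And>x. V (V (W (W x))) = L\<^sup>2 *\<^sub>R W (W x) - x"
    "\<And>B. bounded_linear B \<Longrightarrow> commuting B W \<Longrightarrow> commuting B V"
proof -
  obtain R where R: "selfadjoint R" "\<And>x. W (R x) = x" "\<And>x. R (W x) = x"
    using selfadjoint_obtain_inverse[OF W] by blast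
  obtain L where L: "k \<le> L" "\<And>x. norm (R x) \<le> L * norm x"
    using selfadjoint_obtain_bound[OF R(1)] by blast
  have "0 \<le> L" using L(1) k by simp
  then obtain V where V: "selfadjoint V" "\<And>x. R (R x) + V (V x) = L\<^sup>2 *\<^sub>R x"
    "\<And>B. bounded_linear B \<Longrightarrow> commuting B R \<Longrightarrow> commuting B V"
    using selfadjoint_complementary_square[OF R(1) _ L(2)] by blast
  show ?thesis
  proof (rule that[OF L(1) V(1)])
    show "V (V (W (W x))) = L\<^sup>2 *\<^sub>R W (W x) - x" for x
      using V(2)[of "W (W x)"] by (simp add: R(3) eq_diff_eq add.commute)
    show "commuting B V" if "bounded_linear B" "commuting B W" for B
      by (rule V(3)[OF that(1) commuting_inverse[OF that(2) R(2,3)]])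
  qed
qed

text \<open>If \<open>L\<^sup>2 - W\<^sup>-\<^sup>2 = V\<^sup>2\<close>, then \<open>W\<^sup>2 - 1 / L\<^sup>2 = (V W / L)\<^sup>2\<close>.\<close>

lemma selfadjoint_invertible_square_diff:
  assumes W: "selfadjoint W" "invertible_op W" and e: "e > 0"
  obtains \<delta> Z where "0 < \<delta>" "\<delta> \<le> e" "selfadjoint Z" "\<And>x. Z (Z x) = W (W x) - \<delta> *\<^sub>R x"
    "\<And>B. bounded_linear B \<Longrightarrow> commuting B W \<Longrightarrow> commuting B Z"
proof -
  interpret W: bounded_linear W by (rule selfadjoint_bounded_linear[OF W(1)])
  have "0 < 1 / sqrt e" using e by simp
  then obtain L V where L: "1 / sqrt e \<le> L" and V: "selfadjoint V"
    "\<And>x. V (V (W (W x))) = L\<^sup>2 *\<^sub>R W (W x) - x"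
    "\<And>B. bounded_linear B \<Longrightarrow> commuting B W \<Longrightarrow> commuting B V"
    using selfadjoint_inverse_complementary_square[OF W] by blast
  have L_pos: "L > 0" using L \<open>0 < 1 / sqrt e\<close> by linarith
  interpret V: bounded_linear V by (rule selfadjoint_bounded_linear[OF V(1)])
  have WV: "commuting W V" by (rule V(3)[OF W.bounded_linear_axioms commuting_refl])
  define Z where "Z = (\<lambda>x. V (W x) /\<^sub>R L)"
  show ?thesis
  proof (rule that)
    show "0 < 1 / L\<^sup>2" using L_pos by simp
    have "(1 / sqrt e)\<^sup>2 \<le> L\<^sup>2" using L e by (intro power_mono) simp_all
    then show "1 / L\<^sup>2 \<le> e" using L_pos e by (simp add: field_simps)
    show "selfadjoint Z"
      unfolding Z_def
      by (intro selfadjoint_scaleR selfadjoint_comp[OF V(1) W(1) commuting_sym[OF WV]])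
    have "Z (Z x) = V (V (W (W x))) /\<^sub>R L\<^sup>2" for x
      by (simp add: Z_def V.scaleR W.scaleR commutingD[OF WV] power2_eq_square)
    then show "Z (Z x) = W (W x) - (1 / L\<^sup>2) *\<^sub>R x" for x
      using L_pos by (simp add: V(2) scaleR_diff_right inverse_eq_divide)
    show "commuting B Z" if B: "bounded_linear B" "commuting B W" for B
      using linear_cmul[OF bounded_linear.linear[OF B(1)]]
      by (simp add: commuting_def Z_def commutingD[OF V(3)[OF B]] commutingD[OF B(2)])
  qed
qed

text \<open>With \<open>K\<^sup>2 - B\<^sup>2 = W\<^sup>2\<close>, the operators \<open>B\<close> and \<open>Z\<close> commute and \<open>B\<^sup>2 + Z\<^sup>2 = K\<^sup>2 - \<delta>\<close>.\<close>

lemma selfadjoint_norm_bound_strict: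
  assumes B: "selfadjoint B" and K: "K > 0" "\<And>x. norm (B x) \<le> K * norm x"
    and inv: "invertible_op (\<lambda>x. K *\<^sub>R x - B x)" "invertible_op (\<lambda>x. K *\<^sub>R x + B x)"
  obtains K' where "0 \<le> K'" "K' < K" "\<And>x. norm (B x) \<le> K' * norm x"
proof -
  interpret B: bounded_linear B by (rule selfadjoint_bounded_linear[OF B])
  obtain W where W: "selfadjoint W" "\<And>x. B (B x) + W (W x) = K\<^sup>2 *\<^sub>R x"
    "\<And>A. bounded_linear A \<Longrightarrow> commuting A B \<Longrightarrow> commuting A W"
    using selfadjoint_complementary_square[OF B less_imp_le[OF K(1)] K(2)] by blast
  have W_square: "W (W x) = K\<^sup>2 *\<^sub>R x - B (B x)" for x by (simp flip: W(2)[of x])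
  have "W (W x) = K *\<^sub>R (K *\<^sub>R x + B x) - B (K *\<^sub>R x + B x)" for x
    by (simp add: W_square B.add B.scaleR algebra_simps power2_eq_square)
  then have "invertible_op (\<lambda>x. W (W x))" using invertible_op_comp[OF inv] by simp
  then have "invertible_op W"
    by (rule invertible_op_of_comp[OF selfadjointD[OF W(1)] commuting_refl])
  moreover have "K\<^sup>2 > 0" using K(1) by simp
  ultimately obtain \<delta> Z where \<delta>: "0 < \<delta>" "\<delta> \<le> K\<^sup>2" and Z: "selfadjoint Z"
    "\<And>x. Z (Z x) = W (W x) - \<delta> *\<^sub>R x"
    "\<And>A. bounded_linear A \<Longrightarrow> commuting A W \<Longrightarrow> commuting A Z"
    using selfadjoint_invertible_square_diff[OF W(1)] by blast
  have "commuting B W" by (rule W(3)[OF B.bounded_linear_axioms commuting_refl])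
  then have "commuting B Z" by (rule Z(3)[OF B.bounded_linear_axioms])
  moreover have "B (B x) + Z (Z x) = (K\<^sup>2 - \<delta>) *\<^sub>R x" for x
    by (simp add: Z(2) W_square scaleR_diff_left)
  ultimately have "norm (B x) \<le> sqrt (K\<^sup>2 - \<delta>) * norm x" for x
    using \<delta> by (intro norm_le_of_sum_of_squares[OF B Z(1)]) simp_all
  moreover have "sqrt (K\<^sup>2 - \<delta>) < K" using K(1) \<delta> by (intro real_less_lsqrt) simp_all
  ultimately show ?thesis using \<delta> that[of "sqrt (K\<^sup>2 - \<delta>)"] by simp
qed

lemma selfadjoint_norm_le_of_invertible:
  assumes B: "selfadjoint B" and "0 \<le> M"
    and inv: "\<And>r. r > M \<Longrightarrow> invertible_op (\<lambda>x. r *\<^sub>R x - B x)"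
      "\<And>r. r > M \<Longrightarrow> invertible_op (\<lambda>x. r *\<^sub>R x + B x)"
  shows "norm (B x) \<le> M * norm x"
proof -
  note onorm_B = onorm[OF selfadjoint_bounded_linear[OF B]]
  have "onorm B \<le> M"
  proof (rule ccontr)
    assume "\<not> onorm B \<le> M"
    then have "onorm B > M" "onorm B > 0" using \<open>0 \<le> M\<close> by auto
    then obtain K' where "0 \<le> K'" "K' < onorm B" "\<And>x. norm (B x) \<le> K' * norm x"
      using selfadjoint_norm_bound_strict[OF B _ onorm_B] inv by blast
    then show False using onorm_bound[of K' B] by auto
  qed
  then show ?thesis by (rule order.trans[OF onorm_B mult_right_mono]) simp
qed

lemma positive_op_of_invertible_shifts:
  assumes R: "selfadjoint R" and inv: "\<And>s. s > 0 \<Longrightarrow> invertible_op (\<lambda>x. s *\<^sub>R x + R x)"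
  shows "positive_op R"
proof -
  obtain K where K: "0 \<le> K" "\<And>x. norm (R x) \<le> K * norm x"
    using selfadjoint_obtain_bound[OF R, of 0] by blast
  have "norm (K *\<^sub>R x - R x) \<le> K * norm x" for x
  proof (rule selfadjoint_norm_le_of_invertible[OF _ K(1)])
    show "selfadjoint (\<lambda>x. K *\<^sub>R x - R x)" by (intro selfadjoint_intros R)
    fix r assume r: "r > K"
    show "invertible_op (\<lambda>x. r *\<^sub>R x - (K *\<^sub>R x - R x))"
      using inv[of "r - K"] r by (simp add: algebra_simps)
    show "invertible_op (\<lambda>x. r *\<^sub>R x + (K *\<^sub>R x - R x))"
      using invertible_op_scaleR_diff[OF R K(1) _ K(2), of "r + K"] r K(1)
      by (simp add: algebra_simps)
  qed
  then show ?thesis by (rule positive_opI[OF R K(1)])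
qed

lemma op_positive_iff: "op_positive ip R \<longleftrightarrow> positive_op R"
proof -
  have negative: "invertible_op (\<lambda>x. of_real (- s) *\<^sub>C x - R x)
      \<longleftrightarrow> invertible_op (\<lambda>x. s *\<^sub>R x + R x)" for s
  proof -
    have "(\<lambda>x. of_real (- s) *\<^sub>C x - R x) = (\<lambda>x. - (s *\<^sub>R x + R x))"
      by (simp only: scaleC_of_real) simp
    then show ?thesis by (simp only: invertible_op_minus_iff)
  qed
  have "op_spectrum ip R \<subseteq> \<real>\<^sub>\<ge>\<^sub>0 \<longleftrightarrow> positive_op R" if R: "selfadjoint R"
  proof
    assume "op_spectrum ip R \<subseteq> \<real>\<^sub>\<ge>\<^sub>0"
    moreover have "of_real (- s) \<notin> \<real>\<^sub>\<ge>\<^sub>0" if "s > 0" for s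
      using that by (simp only: nonneg_Reals_of_real_iff)
    ultimately have "invertible_op (\<lambda>x. s *\<^sub>R x + R x)" if "s > 0" for s
      using that unfolding op_spectrum_eq by (subst negative[symmetric]) blast
    then show "positive_op R" by (rule positive_op_of_invertible_shifts[OF R])
  next
    assume P: "positive_op R"
    show "op_spectrum ip R \<subseteq> \<real>\<^sub>\<ge>\<^sub>0"
    proof
      fix c
      assume "c \<in> op_spectrum ip R"
      then have c: "\<not> invertible_op (\<lambda>x. c *\<^sub>C x - R x)" by (simp add: op_spectrum_eq)
      then have "Im c = 0" using selfadjoint_invertible_nonreal_shift[OF R] by blast
      then have "c = of_real (- (- Re c))" by (simp add: complex_eq_iff)
      then have "\<not> invertible_op (\<lambda>x. (- Re c) *\<^sub>R x + R x)" using c negative by metis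
      then have "\<not> - Re c > 0" using positive_op_invertible_shift[OF P] by blast
      then show "c \<in> \<real>\<^sub>\<ge>\<^sub>0" using \<open>Im c = 0\<close> by (simp add: complex_nonneg_Reals_iff)
    qed
  qed
  then show ?thesis
    unfolding op_positive_def using selfadjoint_iff_adj positive_op_selfadjoint by blast
qed

lemma op_sqrt_eqI:
  assumes "positive_op R" "\<And>x. R (R x) = S x" shows "op_sqrt ip S = R"
  unfolding op_sqrt_def op_positive_iff
proof (rule the_equality)
  show "positive_op R \<and> R \<circ> R = S" using assms by auto
  show "Q = R" if "positive_op Q \<and> Q \<circ> Q = S" for Q
    using that assms by (intro positive_op_sqrt_unique) auto
qed

lemma
  assumes S: "positive_op S"
  shows positive_op_op_sqrt: "positive_op (op_sqrt ip S)"
    and op_sqrt_op_sqrt: "op_sqrt ip S (op_sqrt ip S x) = S x"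
    and commuting_op_sqrt: "bounded_linear B \<Longrightarrow> commuting B S \<Longrightarrow> commuting B (op_sqrt ip S)"
proof -
  obtain C where C: "positive_op C" "\<And>x. C (C x) = S x"
    "\<And>B. bounded_linear B \<Longrightarrow> commuting B S \<Longrightarrow> commuting B C"
    using positive_op_sqrt_exists[OF S] by blast
  have "op_sqrt ip S = C" by (rule op_sqrt_eqI[OF C(1,2)])
  then show "positive_op (op_sqrt ip S)" "op_sqrt ip S (op_sqrt ip S x) = S x"
    "bounded_linear B \<Longrightarrow> commuting B S \<Longrightarrow> commuting B (op_sqrt ip S)"
    using C by simp_all
qed

end

section \<open>Hilbert modules\<close>

text \<open>The assumption is all that the positivity of \<open>S\<^sup>* S\<close> needs from the positivity of \<open>ip x x\<close>.\<close>

locale formally_real_module = cauchy_schwarz_module ip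
  for ip :: "'h::complex_banach \<Rightarrow> 'h \<Rightarrow> 'a::cstar_algebra" +
  assumes ip_sum_eq_zero: "ip x x + ip y y = 0 \<Longrightarrow> x = 0"
begin

text \<open>
  For \<open>R = S\<^sup>* S\<close> and \<open>C = \<bar>R\<bar>\<close>, the operator \<open>D = C - R\<close> is twice the negative part of \<open>R\<close>; it
  vanishes because \<open>R D = - C D\<close>.
\<close>

lemma positive_op_adjoint_comp:
  assumes S: "adjoint_pair S S'" shows "positive_op (\<lambda>x. S' (S x))"
proof -
  define R where "R = (\<lambda>x. S' (S x))"
  have R: "selfadjoint R"
    unfolding R_def selfadjoint_def by (rule adjoint_pair_comp[OF adjoint_pair_sym[OF S] S])
  obtain C where C: "positive_op C" "\<And>x. C (C x) = R (R x)"
    "\<And>B. bounded_linear B \<Longrightarrow> commuting B (\<lambda>x. R (R x)) \<Longrightarrow> commuting B C"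
    using positive_op_sqrt_exists[OF positive_op_square[OF R]] by blast
  interpret R: bounded_linear R by (rule selfadjoint_bounded_linear[OF R])
  interpret C: bounded_linear C by (rule positive_op_bounded_linear[OF C(1)])
  have RC: "commuting R C"
    by (rule C(3)[OF R.bounded_linear_axioms]) (simp add: commuting_def)
  define D where "D = (\<lambda>x. C x - R x)"
  have D: "selfadjoint D"
    unfolding D_def by (intro selfadjoint_intros R positive_op_selfadjoint[OF C(1)])
  have RD: "R (D x) = - C (D x)" for x
    by (simp add: D_def R.diff C.diff C(2) commutingD[OF RC])
  obtain E where E: "positive_op E" "\<And>x. E (E x) = C x"
    by (rule positive_op_sqrt_exists[OF C(1)]) (rule that)
  note E_pair = selfadjointD[OF positive_op_selfadjoint[OF E(1)]]
  have "E (D x) = 0" for x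
  proof (rule ip_sum_eq_zero)
    have "ip (S (D x)) (S (D x)) = ip (D x) (R (D x))" by (simp add: adjoint_pairD[OF S] R_def)
    also have "\<dots> = - ip (E (D x)) (E (D x))"
      by (simp add: RD ip.minus_right adjoint_pairD[OF E_pair] E(2))
    finally show "ip (E (D x)) (E (D x)) + ip (S (D x)) (S (D x)) = 0" by simp
  qed
  then have "C (D x) = 0" for x by (metis E(2) adjoint_pair_zero[OF E_pair])
  moreover have "D y = C y - R y" for y by (simp add: D_def)
  ultimately have "D (D x) = 0" for x by (metis RD diff_self minus_zero)
  then have "D x = 0" for x by (rule selfadjoint_square_eq_zero[OF D])
  then have "C = R" by (auto simp: D_def)
  then show ?thesis using C(1) by (simp add: R_def)
qed

lemma positive_op_conj:
  assumes R: "positive_op R" and S: "adjoint_pair S S'" shows "positive_op (\<lambda>x. S (R (S' x)))"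
proof -
  obtain C where C: "positive_op C" "\<And>x. C (C x) = R x"
    by (rule positive_op_sqrt_exists[OF R]) (rule that)
  from positive_op_adjoint_comp[OF adjoint_pair_comp[OF
      selfadjointD[OF positive_op_selfadjoint[OF C(1)]] adjoint_pair_sym[OF S]]]
  show ?thesis by (simp add: C(2))
qed

lemma
  assumes S: "adjoint_pair S S'"
  shows positive_op_op_abs: "positive_op (op_abs ip S)"
    and op_abs_op_abs: "op_abs ip S (op_abs ip S x) = S' (S x)"
    and commuting_op_abs:
      "bounded_linear B \<Longrightarrow> commuting B (\<lambda>x. S' (S x)) \<Longrightarrow> commuting B (op_abs ip S)"
proof -
  have "op_abs ip S = op_sqrt ip (\<lambda>x. S' (S x))"
    by (simp add: op_abs_def adjoint_pair_adj_eq[OF S] comp_def)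
  then show "positive_op (op_abs ip S)" "op_abs ip S (op_abs ip S x) = S' (S x)"
    "bounded_linear B \<Longrightarrow> commuting B (\<lambda>x. S' (S x)) \<Longrightarrow> commuting B (op_abs ip S)"
    using positive_op_op_sqrt op_sqrt_op_sqrt commuting_op_sqrt positive_op_adjoint_comp[OF S]
    by simp_all
qed

lemma op_abs_eqI:
  assumes S: "adjoint_pair S S'" and R: "positive_op R" "\<And>x. R (R x) = S' (S x)"
  shows "op_abs ip S = R"
  using op_sqrt_eqI[OF R] by (simp add: op_abs_def adjoint_pair_adj_eq[OF S] comp_def)

lemma selfadjoint_op_abs: "adjoint_pair S S' \<Longrightarrow> selfadjoint (op_abs ip S)"
  by (rule positive_op_selfadjoint[OF positive_op_op_abs])

lemma op_abs_eq_zero_iff: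
  assumes S: "adjoint_pair S S'" shows "op_abs ip S x = 0 \<longleftrightarrow> S x = 0"
proof -
  have "ip (op_abs ip S x) (op_abs ip S x) = ip (S x) (S x)"
    by (simp add: adjoint_pairD[OF S] adjoint_pairD[OF selfadjointD[OF selfadjoint_op_abs[OF S]]]
        op_abs_op_abs[OF S])
  then show ?thesis by (metis ip_self_eq_zero_iff)
qed

lemma commuting_op_abs_iff:
  assumes S: "adjoint_pair S S'" and Q: "adjoint_pair Q Q'"
  shows "commuting (op_abs ip S) (op_abs ip Q) \<longleftrightarrow> commuting (\<lambda>x. S' (S x)) (\<lambda>x. Q' (Q x))"
proof
  assume "commuting (op_abs ip S) (op_abs ip Q)"
  then show "commuting (\<lambda>x. S' (S x)) (\<lambda>x. Q' (Q x))"
    by (simp add: commuting_def flip: op_abs_op_abs[OF S] op_abs_op_abs[OF Q])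
next
  have S_bounded: "bounded_linear (\<lambda>x. S' (S x))"
    by (rule adjoint_pair_bounded_linear[OF adjoint_pair_comp[OF adjoint_pair_sym[OF S] S]])
  have Q_bounded: "bounded_linear (op_abs ip Q)"
    by (rule positive_op_bounded_linear[OF positive_op_op_abs[OF Q]])
  assume "commuting (\<lambda>x. S' (S x)) (\<lambda>x. Q' (Q x))"
  then have "commuting (op_abs ip Q) (\<lambda>x. S' (S x))"
    by (rule commuting_sym[OF commuting_op_abs[OF Q S_bounded]])
  then show "commuting (op_abs ip S) (op_abs ip Q)"
    by (rule commuting_sym[OF commuting_op_abs[OF S Q_bounded]])
qed

end

lemma star_scaleR: "star (r *\<^sub>R x) = r *\<^sub>R star (x :: 'a::cstar_algebra)"
  by (metis complex_cnj_complex_of_real scaleC_of_real star_scaleC)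

lemma norm_star [simp]: "norm (star x) = norm (x :: 'a::cstar_algebra)"
proof -
  have "norm y \<le> norm (star y)" for y :: 'a
    using cstar_identity[of y] norm_mult_ineq[of "star y" y]
    by (cases "y = 0") (simp_all add: power2_eq_square)
  from this[of x] this[of "star x"] show ?thesis by (simp add: star_star)
qed

interpretation cstar: cauchy_schwarz_module "\<lambda>a b :: 'a::cstar_algebra. star a * b"
proof
  show "star x * (y + z) = star x * y + star x * z" for x y z :: 'a by (rule distrib_left)
  show "star x * (c *\<^sub>C y) = c *\<^sub>C (star x * y)" for c and x y :: 'a by (rule mult_scaleC_right)
  show "star y * x = star (star x * y)" for x y :: 'a by (simp add: star_mult star_star)
  show "norm (star x * x) = (norm x)\<^sup>2" for x :: 'a by (rule cstar_identity)
  show "norm (star x * y) \<le> norm x * norm y" for x y :: 'a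
    using norm_mult_ineq[of "star x" y] by simp
qed

lemma cstar_adjoint_pair_mult: "cstar.adjoint_pair (\<lambda>y. a * y) (\<lambda>y. star a * y)"
  by (rule cstar.adjoint_pairI) (simp add: star_mult mult.assoc)

lemma cstar_selfadjoint_mult: "star a = a \<Longrightarrow> cstar.selfadjoint (\<lambda>y. a * y)"
  using cstar_adjoint_pair_mult[of a] by (simp add: cstar.selfadjoint_def)

lemma cstar_positive_op_square:
  assumes "star a = a" shows "cstar.positive_op (\<lambda>y. a * a * y)"
  using cstar.positive_op_square[OF cstar_selfadjoint_mult[OF assms]] by (simp add: mult.assoc)

text \<open>
  If \<open>(w\<^sub>1, w\<^sub>2)\<close> inverts \<open>(- s, - a)\<close> in the unitization, then \<open>y \<mapsto> - w\<^sub>1 y - w\<^sub>2 y\<close> inverts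
  \<open>y \<mapsto> s y + a y\<close>.
\<close>

lemma cstar_positive_op_of_positive:
  assumes a: "cstar_positive a" shows "cstar.positive_op (\<lambda>y. a * y)"
proof (rule cstar.positive_op_of_invertible_shifts)
  show "cstar.selfadjoint (\<lambda>y. a * y)"
    using a by (intro cstar_selfadjoint_mult) (simp add: cstar_positive_def)
  fix s :: real
  assume "s > 0"
  then have "of_real (- s) \<notin> (\<real>\<^sub>\<ge>\<^sub>0 :: complex set)" by (simp only: nonneg_Reals_of_real_iff)
  then have "of_real (- s) \<notin> cstar_spectrum a" using a by (auto simp: cstar_positive_def)
  then obtain w\<^sub>1 w\<^sub>2 where
    right: "unitization_mult (of_real (- s), - a) (w\<^sub>1, w\<^sub>2) = (1, 0)" and
    left: "unitization_mult (w\<^sub>1, w\<^sub>2) (of_real (- s), - a) = (1, 0)"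
    unfolding cstar_spectrum_def by auto
  define v\<^sub>1 v\<^sub>2 where "v\<^sub>1 = - w\<^sub>1" and "v\<^sub>2 = - w\<^sub>2"
  note v_defs = v\<^sub>1_def v\<^sub>2_def
  have sv: "of_real s * v\<^sub>1 = 1" using right by (simp add: v_defs unitization_mult_def)
  have R: "s *\<^sub>R v\<^sub>2 + v\<^sub>1 *\<^sub>C a + a * v\<^sub>2 = 0" and L: "s *\<^sub>R v\<^sub>2 + v\<^sub>1 *\<^sub>C a + v\<^sub>2 * a = 0"
    using right left
    by (simp_all add: v_defs unitization_mult_def scaleC_minus_left scaleC_minus_right
        algebra_simps flip: scaleC_of_real)
  define Q where "Q = (\<lambda>y. v\<^sub>1 *\<^sub>C y + v\<^sub>2 * y)"
  have sv_scale: "s *\<^sub>R (v\<^sub>1 *\<^sub>C y) = y" "v\<^sub>1 *\<^sub>C (s *\<^sub>R y) = y" for y :: 'a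
    using sv by (simp_all add: scaleC_scaleC mult.commute flip: scaleC_of_real)
  show "cstar.invertible_op (\<lambda>y. s *\<^sub>R y + a * y)"
  proof (rule cstar.invertible_opI)
    show "cstar.adjoint_pair Q (\<lambda>y. cnj v\<^sub>1 *\<^sub>C y + star v\<^sub>2 * y)"
      unfolding Q_def
      by (intro cstar.adjoint_pair_add cstar.adjoint_pair_scaleC cstar.adjoint_pair_id
          cstar_adjoint_pair_mult)
    fix y
    have "s *\<^sub>R Q y + a * Q y = y + (s *\<^sub>R v\<^sub>2 + v\<^sub>1 *\<^sub>C a + a * v\<^sub>2) * y"
      by (simp add: Q_def sv_scale scaleR_add_right distrib_left distrib_right mult_scaleC_left
          mult_scaleC_right mult.assoc)
    then show "s *\<^sub>R Q y + a * Q y = y" by (simp add: R)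
    have "Q (s *\<^sub>R y + a * y) = y + (s *\<^sub>R v\<^sub>2 + v\<^sub>1 *\<^sub>C a + v\<^sub>2 * a) * y"
      by (simp add: Q_def sv_scale scaleC_add_right distrib_left distrib_right mult_scaleC_left
          mult.assoc)
    then show "Q (s *\<^sub>R y + a * y) = y" by (simp add: L)
  qed
qed

lemma norm_le_norm_add_of_positive_op:
  assumes u: "cstar.positive_op (\<lambda>y. u * y)" and v: "cstar.positive_op (\<lambda>y. v * y)"
  shows "norm u \<le> norm (u + v)"
proof (cases "u = 0")
  case False
  have "norm (u * star u) \<le> norm (u + v) * norm (star u)"
    by (rule cstar.positive_op_norm_mono[OF u v]) (simp_all add: norm_mult_ineq flip: distrib_right)
  then have "norm u * norm u \<le> norm (u + v) * norm u"
    using cstar_identity[of "star u"] by (simp add: star_star power2_eq_square)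
  then show ?thesis using False by simp
qed simp

context hilbert_cstar_module
begin

sublocale star_sesquilinear ip
  by standard (rule ip_add_right ip_scaleC_right ip_star)+

lemma norm_ip_self: "norm (ip x x) = (norm x)\<^sup>2"
  by (simp add: norm_eq_sqrt_ip)

lemma ip_act_left: "ip (act x a) y = star a * ip x y"
  by (metis ip_act_right ip_star star_mult)

lemma norm_act_le: "norm (act x a) \<le> norm a * norm x"
proof (rule power2_le_imp_le)
  have "(norm (act x a))\<^sup>2 = norm (star a * ip x x * a)"
    by (simp add: ip_act_left ip_act_right mult.assoc flip: norm_ip_self)
  also have "\<dots> \<le> (norm a * (norm x)\<^sup>2) * norm a"
    by (rule order.trans[OF norm_mult_ineq mult_right_mono])
      (use norm_mult_ineq[of "star a" "ip x x"] in \<open>simp_all add: norm_ip_self\<close>)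
  finally show "(norm (act x a))\<^sup>2 \<le> (norm a * norm x)\<^sup>2"
    by (simp add: power2_eq_square mult_ac)
qed simp

text \<open>
  Positivity of \<open>star h * h\<close> is only available for self-adjoint \<open>h\<close>; the general case is reduced to
  this one by replacing \<open>y\<close> with \<open>act y (star (ip x y))\<close>.
\<close>

lemma Cauchy_Schwarz_selfadjoint:
  assumes h: "star (ip x y) = ip x y" shows "norm (ip x y) \<le> norm x * norm y"
proof (cases "x = 0")
  case True
  then show ?thesis using ip_diff_left[of 0 0 y] by simp
next
  case False
  define h where "h = ip x y"
  have star_h: "star h = h" "ip y x = h" using h ip_star[of y x] by (simp_all add: h_def)
  define t where "t = 1 / (norm x)\<^sup>2"
  have t: "t > 0" "t * (norm x)\<^sup>2 = 1" using False by (simp_all add: t_def)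
  define k where "k = t *\<^sub>R h"
  define z where "z = act x k - y"
  have star_k: "star k = k" by (simp add: k_def star_scaleR star_h)
  have norm_h_square: "norm (h * h) = (norm h)\<^sup>2" using cstar_identity[of h] star_h by simp
  have "(k * h + h * k) + ip z z = k * ip x x * k + ip y y"
    by (simp add: z_def ip_diff_left ip_diff_right ip_act_left ip_act_right star_h star_k
        left_diff_distrib mult.assoc flip: h_def)
  moreover have "k * h + h * k = (2 * t) *\<^sub>R (h * h)" by (simp add: k_def flip: scaleR_2)
  ultimately have sum: "(2 * t) *\<^sub>R (h * h) + ip z z = k * ip x x * k + ip y y" by simp
  have "cstar.positive_op (\<lambda>a. (2 * t) *\<^sub>R (h * h) * a)"
    using cstar_positive_op_square[of "sqrt (2 * t) *\<^sub>R h"] t(1) by (simp add: star_scaleR star_h)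
  then have "norm ((2 * t) *\<^sub>R (h * h)) \<le> norm ((2 * t) *\<^sub>R (h * h) + ip z z)"
    by (rule norm_le_norm_add_of_positive_op[OF _ cstar_positive_op_of_positive[OF ip_positive]])
  then have "2 * t * norm (h * h) \<le> norm (k * ip x x * k + ip y y)" using t(1) by (simp add: sum)
  also have "\<dots> \<le> norm k * (norm x)\<^sup>2 * norm k + (norm y)\<^sup>2"
  proof (rule norm_triangle_mono)
    show "norm (k * ip x x * k) \<le> norm k * (norm x)\<^sup>2 * norm k"
      by (rule order.trans[OF norm_mult_ineq mult_right_mono])
        (use norm_mult_ineq[of k "ip x x"] in \<open>simp_all add: norm_ip_self\<close>)
  qed (simp add: norm_ip_self)
  also have "norm k * (norm x)\<^sup>2 * norm k = t * (norm h)\<^sup>2"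
    using t by (simp add: k_def power2_eq_square mult_ac)
  finally have "t * (norm h)\<^sup>2 \<le> (norm y)\<^sup>2" by (simp add: norm_h_square)
  then have "(norm h)\<^sup>2 \<le> (norm x * norm y)\<^sup>2"
    using False by (simp add: t_def power_mult_distrib field_simps)
  then show ?thesis unfolding h_def by (rule power2_le_imp_le) simp
qed

sublocale cauchy_schwarz_module ip
proof
  fix x y
  show "norm (ip x x) = (norm x)\<^sup>2" by (rule norm_ip_self)
  show "norm (ip x y) \<le> norm x * norm y"
  proof (cases "ip x y = 0")
    case False
    define a where "a = ip x y"
    have ip_act: "ip x (act y (star a)) = a * star a" by (simp add: ip_act_right a_def)
    have "norm a * norm a = norm (a * star a)"
      using cstar_identity[of "star a"] by (simp add: star_star power2_eq_square)
    also have "\<dots> \<le> norm x * norm (act y (star a))"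
      using Cauchy_Schwarz_selfadjoint[of x "act y (star a)"]
      unfolding ip_act by (simp add: star_mult star_star)
    also have "\<dots> \<le> norm x * (norm a * norm y)"
      using norm_act_le[of y "star a"] by (intro mult_left_mono) simp_all
    finally have "norm a * norm a \<le> (norm x * norm y) * norm a" by (simp add: mult_ac)
    then show ?thesis using False by (simp add: a_def)
  qed simp
qed

sublocale formally_real_module ip
proof
  fix x y
  assume "ip x x + ip y y = 0"
  then show "x = 0"
    using norm_le_norm_add_of_positive_op[OF cstar_positive_op_of_positive[OF ip_positive[of x]]
        cstar_positive_op_of_positive[OF ip_positive[of y]]]
    by (simp add: ip_eq_zero_iff)
qed

end

context cauchy_schwarz_module
begin

section \<open>Polar decomposition\<close>

lemma orth_proj_eqI:
  assumes "y \<in> M" "x - y \<in> orth_compl ip M" shows "orth_proj ip M x = y"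
  unfolding orth_proj_def
proof (rule the_equality)
  fix w
  assume w: "w \<in> M \<and> x - w \<in> orth_compl ip M"
  have "ip (w - y) m = 0" if "m \<in> M" for m
    using assms(2) w that ip_diff_left[of "x - y" "x - w" m] by (simp add: orth_compl_def)
  then have "ip (w - y) (w - y) = 0" using assms(1) w by (simp add: ip_diff_right)
  then show "w = y" by (simp add: ip_self_eq_zero_iff)
qed (use assms in simp)

lemma orth_complemented_orth_proj:
  assumes "orth_complemented ip M"
  shows "orth_proj ip M x \<in> M" and "x - orth_proj ip M x \<in> orth_compl ip M"
proof -
  have "x \<in> {u + v | u v. u \<in> M \<and> v \<in> orth_compl ip M}"
    using assms by (simp add: orth_complemented_def)
  then obtain u v where uv: "x = u + v" "u \<in> M" "v \<in> orth_compl ip M" by blast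
  then have "orth_proj ip M x = u" by (intro orth_proj_eqI) simp_all
  then show "orth_proj ip M x \<in> M" "x - orth_proj ip M x \<in> orth_compl ip M"
    using uv by simp_all
qed

lemma
  assumes P: "selfadjoint P" "\<And>x. P x \<in> M" "\<And>y. y \<in> M \<Longrightarrow> P y = y"
  shows orth_complemented_of_projection: "orth_complemented ip M"
    and orth_proj_of_projection: "orth_proj ip M = P"
proof -
  have P_compl: "x - P x \<in> orth_compl ip M" for x
    unfolding orth_compl_def
  proof (intro CollectI ballI)
    fix m
    assume "m \<in> M"
    then have "ip (x - P x) m = ip (x - P x) (P m)" by (simp add: P(3))
    also have "\<dots> = ip (P (x - P x)) m" by (simp add: adjoint_pairD[OF selfadjointD[OF P(1)]])
    also have "P (x - P x) = 0"
      using P(2,3) adjoint_pair_linear_diff[OF selfadjointD[OF P(1)]] by simp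
    finally show "ip (x - P x) m = 0" by (simp add: ip.zero_left)
  qed
  show "orth_proj ip M = P" using P(2) P_compl by (intro ext orth_proj_eqI)
  have "\<exists>u v. x = u + v \<and> u \<in> M \<and> v \<in> orth_compl ip M" for x
    using P(2) P_compl by (intro exI[of _ "P x"] exI[of _ "x - P x"]) simp
  moreover have "0 \<in> M" using P(2)[of 0] adjoint_pair_zero[OF selfadjointD[OF P(1)]] by simp
  ultimately show "orth_complemented ip M"
    by (auto simp: orth_complemented_def orth_compl_def ip_self_eq_zero_iff ip.zero_left)
qed

end

context formally_real_module
begin

abbreviation adjoint_op :: "('h \<Rightarrow> 'h) \<Rightarrow> 'h \<Rightarrow> 'h"  (\<open>_\<^sup>\<dagger>\<close> [1000] 1000) where
  "S\<^sup>\<dagger> \<equiv> adj ip S"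

abbreviation modulus :: "('h \<Rightarrow> 'h) \<Rightarrow> 'h \<Rightarrow> 'h" where
  "modulus S \<equiv> op_abs ip S"

definition conjugate :: "('h \<Rightarrow> 'h) \<Rightarrow> ('h \<Rightarrow> 'h) \<Rightarrow> 'h \<Rightarrow> 'h" where
  "conjugate S R = S \<circ> R \<circ> S\<^sup>\<dagger>"

lemma conjugate_apply: "conjugate S R x = S (R (S\<^sup>\<dagger> x))"
  by (simp add: conjugate_def)

lemma selfadjoint_conjugate:
  assumes S: "S \<in> adjointable ip" and R: "selfadjoint R" shows "selfadjoint (conjugate S R)"
  using adjoint_pair_comp[OF adjoint_pair_adj[OF S] adjoint_pair_comp[OF selfadjointD[OF R]
      adjoint_pair_sym[OF adjoint_pair_adj[OF S]]]]
  by (simp add: selfadjoint_def conjugate_def comp_def)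

lemma positive_op_conjugate:
  assumes S: "S \<in> adjointable ip" and R: "positive_op R" shows "positive_op (conjugate S R)"
  unfolding conjugate_def comp_def by (rule positive_op_conj[OF R adjoint_pair_adj[OF S]])

lemma conjugate_funpow_0: "conjugate (S ^^ 0) R = R"
  using adjoint_pair_adj_eq[OF adjoint_pair_id] by (simp add: conjugate_def id_def comp_def)

lemma conjugate_funpow_Suc:
  assumes "S \<in> adjointable ip" shows "conjugate (S ^^ Suc m) R = conjugate S (conjugate (S ^^ m) R)"
  unfolding conjugate_def adj_funpow[OF assms] by (simp add: fun_eq_iff funpow_swap1)

lemma modulus_funpow_0: "modulus (S ^^ 0) = id"
  unfolding id_def funpow.simps by (rule op_abs_eqI[OF adjoint_pair_id positive_op_id]) simp

text \<open>Both families in the definition of a centered operator consist of squares of moduli.\<close>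

lemma centered_iff_commuting_moduli:
  assumes S: "S \<in> adjointable ip"
  shows "centered ip S \<longleftrightarrow>
    (\<forall>m\<ge>1. \<forall>n\<ge>1. commuting (modulus (S ^^ m)) (modulus (S ^^ n))
      \<and> commuting (modulus (S ^^ m)) (modulus (S\<^sup>\<dagger> ^^ n))
      \<and> commuting (modulus (S\<^sup>\<dagger> ^^ m)) (modulus (S\<^sup>\<dagger> ^^ n)))"
proof -
  have pair: "adjoint_pair (S ^^ n) (S\<^sup>\<dagger> ^^ n)" "adjoint_pair (S\<^sup>\<dagger> ^^ n) (S ^^ n)" for n
    using adjoint_pair_funpow[OF adjoint_pair_adj[OF S]] adjoint_pair_sym by blast+
  note iff = pair[THEN commuting_op_abs_iff, unfolded comp_def[symmetric]]
  show ?thesis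
    unfolding centered_def commuting_family_def commutator_eq_zero_iff adj_funpow[OF S]
      iff[OF pair(1)] iff[OF pair(2)]
    using commuting_sym by blast
qed

lemma centered_adj_iff: "S \<in> adjointable ip \<Longrightarrow> centered ip (S\<^sup>\<dagger>) \<longleftrightarrow> centered ip S"
  unfolding centered_def by (simp add: adj_funpow adj_adj adj_adjointable Un_commute)

end

locale polar_decomposed = formally_real_module ip
  for ip :: "'h::complex_banach \<Rightarrow> 'h \<Rightarrow> 'a::cstar_algebra" +
  fixes T U :: "'h \<Rightarrow> 'h"
  assumes T_adjointable: "T \<in> adjointable ip"
    and polar: "polar_decomposition ip T U"
begin

lemma U_adjointable: "U \<in> adjointable ip"
  using polar by (simp add: polar_decomposition_def partial_isometry_def)

lemmas adj_simps [simp] = adj_adj[OF T_adjointable] adj_adj[OF U_adjointable]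

lemmas T_pair = adjoint_pair_adj[OF T_adjointable]

lemmas U_pair = adjoint_pair_adj[OF U_adjointable]

lemma adj_T_pair: "adjoint_pair (T\<^sup>\<dagger>) T"
  by (rule adjoint_pair_sym[OF T_pair])

lemma adj_U_pair: "adjoint_pair (U\<^sup>\<dagger>) U"
  by (rule adjoint_pair_sym[OF U_pair])

lemmas selfadjoint_modulus = selfadjoint_op_abs[OF T_pair]

lemma T_eq: "T x = U (modulus T x)"
  using polar unfolding polar_decomposition_def by (metis comp_apply)

lemma U_adj_U_U_adj_U: "U\<^sup>\<dagger> (U (U\<^sup>\<dagger> (U x))) = U\<^sup>\<dagger> (U x)"
  using polar unfolding polar_decomposition_def partial_isometry_def projection_op_def
  by (metis comp_apply)

lemma
  shows initial_projection_in: "U\<^sup>\<dagger> (U x) \<in> closure (range (T\<^sup>\<dagger>))"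
    and initial_projection_compl: "x - U\<^sup>\<dagger> (U x) \<in> orth_compl ip (closure (range (T\<^sup>\<dagger>)))"
proof -
  have "orth_complemented ip (closure (range (T\<^sup>\<dagger>)))"
    "U\<^sup>\<dagger> (U x) = orth_proj ip (closure (range (T\<^sup>\<dagger>))) x"
    using polar unfolding polar_decomposition_def by (simp_all add: fun_eq_iff)
  then show "U\<^sup>\<dagger> (U x) \<in> closure (range (T\<^sup>\<dagger>))"
    "x - U\<^sup>\<dagger> (U x) \<in> orth_compl ip (closure (range (T\<^sup>\<dagger>)))"
    using orth_complemented_orth_proj by simp_all
qed

lemma U_U_adj_U: "U (U\<^sup>\<dagger> (U x)) = U x"
proof -
  let ?z = "x - U\<^sup>\<dagger> (U x)"
  note diff = adjoint_pair_linear_diff[OF U_pair] adjoint_pair_linear_diff[OF adj_U_pair]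
  have "ip (U ?z) (U ?z) = ip ?z (U\<^sup>\<dagger> (U ?z))" by (rule adjoint_pairD[OF U_pair])
  also have "U\<^sup>\<dagger> (U ?z) = 0" by (simp add: diff U_adj_U_U_adj_U)
  finally have "U ?z = 0" by (simp add: ip_self_eq_zero_iff ip.zero_right)
  then show ?thesis by (simp add: diff)
qed

lemma U_adj_U_U_adj: "U\<^sup>\<dagger> (U (U\<^sup>\<dagger> x)) = U\<^sup>\<dagger> x"
proof -
  have "adjoint_pair U (\<lambda>x. U\<^sup>\<dagger> (U (U\<^sup>\<dagger> x)))"
    using adjoint_pair_comp[OF U_pair adjoint_pair_comp[OF adj_U_pair U_pair]]
    by (simp add: U_U_adj_U)
  from adjoint_pair_unique[OF this U_pair] show ?thesis by metis
qed

lemma modulus_initial_projection: "modulus T (U\<^sup>\<dagger> (U x)) = modulus T x"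
proof -
  let ?z = "x - U\<^sup>\<dagger> (U x)"
  have "ip ?z y = 0" if "y \<in> range (T\<^sup>\<dagger>)" for y
    using initial_projection_compl[of x] closure_subset[of "range (T\<^sup>\<dagger>)"] that
    by (auto simp: orth_compl_def)
  then have "ip (T ?z) (T ?z) = 0" by (simp add: adjoint_pairD[OF T_pair])
  then have "modulus T ?z = 0" by (simp add: ip_self_eq_zero_iff op_abs_eq_zero_iff[OF T_pair])
  then show ?thesis by (simp add: adjoint_pair_linear_diff[OF selfadjointD[OF selfadjoint_modulus]])
qed

lemma initial_projection_modulus: "U\<^sup>\<dagger> (U (modulus T x)) = modulus T x"
proof -
  have "adjoint_pair (modulus T) (\<lambda>x. U\<^sup>\<dagger> (U (modulus T x)))"
    using adjoint_pair_comp[OF selfadjointD[OF selfadjoint_modulus]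
        adjoint_pair_comp[OF adj_U_pair U_pair]]
    by (simp add: modulus_initial_projection)
  from adjoint_pair_unique[OF this selfadjointD[OF selfadjoint_modulus]] show ?thesis by metis
qed

lemma U_eq_zero_of_modulus_eq_zero:
  assumes "modulus T x = 0" shows "U x = 0"
proof -
  have "T x = 0" using assms by (simp add: op_abs_eq_zero_iff[OF T_pair])
  then have "range (T\<^sup>\<dagger>) \<subseteq> {y. ip x y = 0}"
    using adjoint_pairD[OF T_pair, of x] by (auto simp: ip.zero_left)
  moreover have "closed {y. ip x y = 0}"
    by (intro closed_Collect_eq continuous_intros linear_continuous_on ip.bounded_linear_right)
  ultimately have "closure (range (T\<^sup>\<dagger>)) \<subseteq> {y. ip x y = 0}" by (rule closure_minimal)
  then have "ip (U x) (U x) = 0"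
    using initial_projection_in[of x] by (auto simp: adjoint_pairD[OF U_pair])
  then show ?thesis by (simp add: ip_self_eq_zero_iff)
qed

lemma U_eq_of_modulus_eq: "modulus T x = modulus T y \<Longrightarrow> U x = U y"
  using U_eq_zero_of_modulus_eq_zero[of "x - y"]
  by (simp add: adjoint_pair_linear_diff[OF U_pair]
      adjoint_pair_linear_diff[OF selfadjointD[OF selfadjoint_modulus]])

lemma adj_T_eq: "T\<^sup>\<dagger> x = modulus T (U\<^sup>\<dagger> x)"
proof -
  have "adjoint_pair T (\<lambda>x. modulus T (U\<^sup>\<dagger> x))"
    using adjoint_pair_comp[OF U_pair selfadjointD[OF selfadjoint_modulus]] by (simp flip: T_eq)
  from adjoint_pair_adj_eq[OF this] show ?thesis by simp
qed

lemma modulus_adj: "modulus (T\<^sup>\<dagger>) = conjugate U (modulus T)"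
proof (rule op_abs_eqI[OF adj_T_pair])
  show "positive_op (conjugate U (modulus T))"
    by (rule positive_op_conjugate[OF U_adjointable positive_op_op_abs[OF T_pair]])
  show "conjugate U (modulus T) (conjugate U (modulus T) x) = T (T\<^sup>\<dagger> x)" for x
    by (simp add: conjugate_apply T_eq adj_T_eq initial_projection_modulus)
qed

lemma conjugate_adj_modulus_adj: "conjugate (U\<^sup>\<dagger>) (modulus (T\<^sup>\<dagger>)) = modulus T"
  by (auto simp: modulus_adj conjugate_apply initial_projection_modulus modulus_initial_projection)

lemma polar_decomposed_adj: "polar_decomposed ip (T\<^sup>\<dagger>) (U\<^sup>\<dagger>)"
proof unfold_locales
  show "T\<^sup>\<dagger> \<in> adjointable ip" by (rule adj_adjointable[OF T_adjointable])
  define P where "P = U \<circ> U\<^sup>\<dagger>"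
  have P: "selfadjoint P"
    unfolding selfadjoint_def P_def comp_def by (rule adjoint_pair_comp[OF U_pair adj_U_pair])
  have "U ` closure (range (T\<^sup>\<dagger>)) \<subseteq> closure (range T)"
  proof (rule image_closure_subset)
    have "U (T\<^sup>\<dagger> x) = T (U\<^sup>\<dagger> x)" for x by (simp add: adj_T_eq T_eq)
    then show "U ` range (T\<^sup>\<dagger>) \<subseteq> closure (range T)" using closure_subset by fastforce
  qed (simp_all add: linear_continuous_on[OF adjoint_pair_bounded_linear[OF U_pair]])
  then have "U (U\<^sup>\<dagger> (U x)) \<in> closure (range T)" for x using initial_projection_in[of x] by blast
  then have P_in: "P x \<in> closure (range T)" for x by (simp add: P_def U_U_adj_U)
  have "closure (range T) \<subseteq> {y. P y = y}"
  proof (rule closure_minimal)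
    show "range T \<subseteq> {y. P y = y}" by (auto simp: P_def T_eq initial_projection_modulus)
    show "closed {y. P y = y}"
      by (intro closed_Collect_eq continuous_intros linear_continuous_on
          selfadjoint_bounded_linear[OF P])
  qed
  then have P_fixed: "P y = y" if "y \<in> closure (range T)" for y using that by blast
  have "projection_op ip P"
    using P by (auto simp: projection_op_def selfadjoint_iff_adj P_def U_U_adj_U)
  moreover have "T\<^sup>\<dagger> = U\<^sup>\<dagger> \<circ> modulus (T\<^sup>\<dagger>)"
    by (simp add: fun_eq_iff modulus_adj conjugate_apply adj_T_eq initial_projection_modulus)
  ultimately show "polar_decomposition ip (T\<^sup>\<dagger>) (U\<^sup>\<dagger>)"
    using orth_complemented_of_projection[OF P P_in P_fixed]
      orth_proj_of_projection[OF P P_in P_fixed]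
    by (simp add: polar_decomposition_def partial_isometry_def adj_adjointable[OF U_adjointable]
        P_def comp_def)
qed

section \<open>Conjugation by the partial isometry\<close>

lemma commuting_initial_projection:
  assumes X: "selfadjoint X" "commuting X (modulus T)"
  shows "X (U\<^sup>\<dagger> (U x)) = U\<^sup>\<dagger> (U (X x))"
proof -
  have "U (X (U\<^sup>\<dagger> (U x))) = U (X x)" for x
    by (rule U_eq_of_modulus_eq) (simp add: modulus_initial_projection flip: commutingD[OF X(2)])
  moreover have initial: "adjoint_pair (\<lambda>x. U\<^sup>\<dagger> (U x)) (\<lambda>x. U\<^sup>\<dagger> (U x))"
    by (rule adjoint_pair_comp[OF adj_U_pair U_pair])
  note initial_X = adjoint_pair_comp[OF initial selfadjointD[OF X(1)]]
  note initial_X_initial = adjoint_pair_comp[OF initial_X initial]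
  ultimately have "(\<lambda>x. X (U\<^sup>\<dagger> (U x))) = (\<lambda>x. U\<^sup>\<dagger> (U (X x)))"
    using adjoint_pair_unique[OF initial_X] initial_X_initial by simp
  then show ?thesis by metis
qed

lemma commuting_conjugate:
  assumes X: "selfadjoint X" "commuting X (modulus T)" and XY: "commuting X Y"
  shows "commuting (conjugate U X) (conjugate U Y)"
proof (rule commutingI)
  fix x
  note swap = commuting_initial_projection[OF X]
  have "conjugate U X (conjugate U Y x) = U (X (Y (U\<^sup>\<dagger> x)))"
    by (simp add: conjugate_apply swap U_U_adj_U)
  also have "\<dots> = conjugate U Y (conjugate U X x)"
    by (simp add: conjugate_apply commutingD[OF XY] U_adj_U_U_adj flip: swap)
  finally show "conjugate U X (conjugate U Y x) = conjugate U Y (conjugate U X x)" .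
qed

lemma commuting_conjugate_adj:
  assumes X: "selfadjoint X" "commuting X (modulus T)" and comm: "commuting (conjugate U X) Z"
  shows "commuting X (conjugate (U\<^sup>\<dagger>) Z)"
proof (rule commutingI)
  fix x
  note swap = commuting_initial_projection[OF X]
  have "X (U\<^sup>\<dagger> (Z (U x))) = U\<^sup>\<dagger> (conjugate U X (Z (U x)))"
    using swap[of "U\<^sup>\<dagger> (Z (U x))"] by (simp add: conjugate_apply U_adj_U_U_adj)
  also have "\<dots> = U\<^sup>\<dagger> (Z (U (X x)))"
    by (simp add: commutingD[OF comm]) (simp add: conjugate_apply swap U_U_adj_U)
  finally show "X (conjugate (U\<^sup>\<dagger>) Z x) = conjugate (U\<^sup>\<dagger>) Z (X x)" by (simp add: conjugate_apply)
qed

lemma commuting_modulus_conjugate_adj: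
  assumes "commuting Z (modulus (T\<^sup>\<dagger>))" shows "commuting (modulus T) (conjugate (U\<^sup>\<dagger>) Z)"
  using commuting_conjugate_adj[OF selfadjoint_modulus commuting_refl]
    commuting_sym[OF assms[unfolded modulus_adj]] by blast

lemma modulus_funpow_Suc:
  assumes comm: "commuting (modulus (T ^^ k)) (modulus (T\<^sup>\<dagger>))"
  shows "modulus (T ^^ Suc k) = modulus T \<circ> conjugate (U\<^sup>\<dagger>) (modulus (T ^^ k))"
proof (rule op_abs_eqI[OF adjoint_pair_funpow[OF T_pair]])
  note pow_pair = adjoint_pair_funpow[OF T_pair, of k]
  let ?A = "modulus (T ^^ k)" let ?W = "conjugate (U\<^sup>\<dagger>) ?A"
  have TW: "commuting (modulus T) ?W" by (rule commuting_modulus_conjugate_adj[OF comm])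
  have "positive_op ?W"
    by (intro positive_op_conjugate adj_adjointable U_adjointable positive_op_op_abs[OF pow_pair])
  then show "positive_op (modulus T \<circ> ?W)"
    unfolding comp_def by (rule positive_op_comp[OF positive_op_op_abs[OF T_pair] _ TW])
  fix x
  have "?W (?W (modulus T x)) = U\<^sup>\<dagger> ((T\<^sup>\<dagger> ^^ k) ((T ^^ k) (T x)))"
    using polar_decomposed.commuting_initial_projection[OF polar_decomposed_adj
        selfadjoint_op_abs[OF pow_pair] comm]
    by (simp add: conjugate_apply U_adj_U_U_adj op_abs_op_abs[OF pow_pair] T_eq)
  then show "(modulus T \<circ> ?W) ((modulus T \<circ> ?W) x) = (T\<^sup>\<dagger> ^^ Suc k) ((T ^^ Suc k) x)"
    by (simp add: commutingD[OF TW] adj_T_eq funpow_swap1[of T])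
qed

text \<open>The implication from left to right uses that the kernel of the modulus of \<open>T\<close> is that of \<open>U\<close>.\<close>

lemma commuting_modulus_funpow_Suc_iff:
  assumes X: "selfadjoint X" "commuting X (modulus T)"
    and comm: "commuting (modulus (T ^^ k)) (modulus (T\<^sup>\<dagger>))"
  shows "commuting X (modulus (T ^^ Suc k)) \<longleftrightarrow> commuting (conjugate U X) (modulus (T ^^ k))"
proof
  assume "commuting (conjugate U X) (modulus (T ^^ k))"
  from commuting_comp[OF X(2) commuting_conjugate_adj[OF X this]]
  show "commuting X (modulus (T ^^ Suc k))" unfolding modulus_funpow_Suc[OF comm] comp_def .
next
  assume comm_Suc: "commuting X (modulus (T ^^ Suc k))"
  let ?A = "modulus (T ^^ k)"
  have A: "selfadjoint ?A" by (rule selfadjoint_op_abs[OF adjoint_pair_funpow[OF T_pair]])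
  have final_projection: "?A (U (U\<^sup>\<dagger> x)) = U (U\<^sup>\<dagger> (?A x))" for x
    using polar_decomposed.commuting_initial_projection[OF polar_decomposed_adj A comm] by simp
  have U_X: "U (X (U\<^sup>\<dagger> (?A (U x)))) = U (U\<^sup>\<dagger> (?A (U (X x))))" for x
  proof (rule U_eq_of_modulus_eq)
    show "modulus T (X (U\<^sup>\<dagger> (?A (U x)))) = modulus T (U\<^sup>\<dagger> (?A (U (X x))))"
      using commutingD[OF comm_Suc[unfolded modulus_funpow_Suc[OF comm]], of x]
      by (simp add: conjugate_apply flip: commutingD[OF X(2)])
  qed
  show "commuting (conjugate U X) ?A"
  proof (rule commutingI)
    fix x
    have "U (X (U\<^sup>\<dagger> (?A x))) = U (X (U\<^sup>\<dagger> (?A (U (U\<^sup>\<dagger> x)))))"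
      by (simp add: final_projection U_adj_U_U_adj)
    also have "\<dots> = ?A (U (X (U\<^sup>\<dagger> x)))"
      unfolding U_X by (simp add: U_U_adj_U flip: final_projection)
    finally show "conjugate U X (?A x) = ?A (conjugate U X x)" by (simp add: conjugate_apply)
  qed
qed

end

section \<open>Centered operators\<close>

lemma restricted_seqD:
  assumes "restricted_seq t" "1 \<le> n" shows "1 \<le> t n" and "t n \<le> n"
proof -
  have "t n \<in> {1..n}" using assms unfolding restricted_seq_def by blast
  then show "1 \<le> t n" "t n \<le> n" by simp_all
qed

context polar_decomposed
begin

lemma U_funpow_adjointable: "U ^^ n \<in> adjointable ip"
  by (rule adjoint_pair_adjointable[OF adjoint_pair_funpow[OF U_pair]])

lemma conjugate_U_funpow_1: "conjugate (U ^^ 1) (modulus T) = modulus (T\<^sup>\<dagger>)"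
  by (simp add: modulus_adj)

text \<open>
  All commutation relations on the diagonal \<open>i + j = n + 1\<close> are equivalent, given those on the
  smaller diagonals.
\<close>

lemma commuting_on_diagonal_iff:
  assumes smaller: "\<And>i j. 1 \<le> i \<Longrightarrow> 1 \<le> j \<Longrightarrow> i + j \<le> n \<Longrightarrow>
      commuting (conjugate (U ^^ i) (modulus T)) (modulus (T ^^ j))"
    and "1 \<le> i" "i \<le> n"
  shows "commuting (conjugate (U ^^ i) (modulus T)) (modulus (T ^^ (n + 1 - i)))
    \<longleftrightarrow> commuting (modulus (T\<^sup>\<dagger>)) (modulus (T ^^ n))"
  using \<open>1 \<le> i\<close> \<open>i \<le> n\<close>
proof (induction i rule: nat_induct_at_least)
  case base
  show ?case unfolding conjugate_U_funpow_1 by simp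
next
  case (Suc i)
  let ?X = "conjugate (U ^^ i) (modulus T)"
  have "commuting ?X (modulus T)" using smaller[of i 1] Suc by simp
  moreover have "commuting (modulus (T ^^ (n - i))) (modulus (T\<^sup>\<dagger>))"
    using commuting_sym[OF smaller[of 1 "n - i", unfolded conjugate_U_funpow_1]] Suc by simp
  ultimately have "commuting ?X (modulus (T ^^ Suc (n - i)))
      \<longleftrightarrow> commuting (conjugate (U ^^ Suc i) (modulus T)) (modulus (T ^^ (n - i)))"
    unfolding conjugate_funpow_Suc[OF U_adjointable]
    by (intro commuting_modulus_funpow_Suc_iff selfadjoint_conjugate U_funpow_adjointable
        selfadjoint_modulus)
  moreover have "Suc (n - i) = n + 1 - i" "n - i = n + 1 - Suc i" using Suc.prems by simp_all
  ultimately show ?case using Suc.IH Suc.prems by (metis Suc_leD)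
qed

lemma commuting_conjugates_of_restricted:
  assumes t: "restricted_seq t"
    and comm: "\<And>n. 1 \<le> n \<Longrightarrow>
      commuting (conjugate (U ^^ t n) (modulus T)) (modulus (T ^^ (n + 1 - t n)))"
    and "1 \<le> m" "1 \<le> k"
  shows "commuting (conjugate (U ^^ m) (modulus T)) (modulus (T ^^ k))"
  using \<open>1 \<le> m\<close> \<open>1 \<le> k\<close>
proof (induction "m + k" arbitrary: m k rule: less_induct)
  case less
  define n where "n = m + k - 1"
  have n: "1 \<le> n" "m \<le> n" "n + 1 - m = k" "n < m + k" using less.prems by (auto simp: n_def)
  have diagonal: "commuting (conjugate (U ^^ i) (modulus T)) (modulus (T ^^ (n + 1 - i)))
      \<longleftrightarrow> commuting (modulus (T\<^sup>\<dagger>)) (modulus (T ^^ n))" if "1 \<le> i" "i \<le> n" for i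
    using that n(4) by (intro commuting_on_diagonal_iff less.hyps) simp_all
  have "commuting (modulus (T\<^sup>\<dagger>)) (modulus (T ^^ n))"
    using diagonal[OF restricted_seqD[OF t n(1)]] comm[OF n(1)] by blast
  then show ?case using diagonal[of m] less.prems(1) n by simp
qed

lemma commuting_modulus_adj_iff_commuting_conjugates:
  "(\<forall>n\<ge>1. commuting (modulus (T ^^ n)) (modulus (T\<^sup>\<dagger>)))
    \<longleftrightarrow> (\<forall>m\<ge>1. \<forall>n\<ge>1. commuting (conjugate (U ^^ m) (modulus T)) (modulus (T ^^ n)))"
proof (intro iffI allI impI)
  fix m n :: nat
  assume mn: "m \<ge> 1" "n \<ge> 1" and comm: "\<forall>n\<ge>1. commuting (modulus (T ^^ n)) (modulus (T\<^sup>\<dagger>))"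
  show "commuting (conjugate (U ^^ m) (modulus T)) (modulus (T ^^ n))"
  proof (rule commuting_conjugates_of_restricted[of "\<lambda>_. 1"])
    show "commuting (conjugate (U ^^ 1) (modulus T)) (modulus (T ^^ (n + 1 - 1)))" if "n \<ge> 1" for n
      unfolding conjugate_U_funpow_1 using commuting_sym[OF comm[rule_format, OF that]] by simp
  qed (use mn in \<open>simp_all add: restricted_seq_def\<close>)
next
  fix n :: nat
  assume "n \<ge> 1"
    and "\<forall>m\<ge>1. \<forall>n\<ge>1. commuting (conjugate (U ^^ m) (modulus T)) (modulus (T ^^ n))"
  then have "commuting (conjugate (U ^^ 1) (modulus T)) (modulus (T ^^ n))" by blast
  then show "commuting (modulus (T ^^ n)) (modulus (T\<^sup>\<dagger>))"
    unfolding conjugate_U_funpow_1 by (rule commuting_sym)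
qed

lemma commuting_conjugates_iff_commuting_conjugates_modulus:
  "(\<forall>m\<ge>1. \<forall>n\<ge>1. commuting (conjugate (U ^^ m) (modulus T)) (modulus (T ^^ n)))
    \<longleftrightarrow> (\<forall>n\<ge>1. commuting (conjugate (U ^^ n) (modulus T)) (modulus T))"
proof
  assume "\<forall>m\<ge>1. \<forall>n\<ge>1. commuting (conjugate (U ^^ m) (modulus T)) (modulus (T ^^ n))"
  then have "\<forall>m\<ge>1. commuting (conjugate (U ^^ m) (modulus T)) (modulus (T ^^ 1))" by blast
  then show "\<forall>m\<ge>1. commuting (conjugate (U ^^ m) (modulus T)) (modulus T)" by simp
next
  have "restricted_seq (\<lambda>n. n)" by (simp add: restricted_seq_def)
  moreover assume "\<forall>n\<ge>1. commuting (conjugate (U ^^ n) (modulus T)) (modulus T)"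
  ultimately show "\<forall>m\<ge>1. \<forall>n\<ge>1. commuting (conjugate (U ^^ m) (modulus T)) (modulus (T ^^ n))"
    using commuting_conjugates_of_restricted[of "\<lambda>n. n"] by simp
qed

lemma commuting_moduli_funpow_adj_funpow:
  assumes comm: "\<And>n. commuting (modulus (T ^^ n)) (modulus (T\<^sup>\<dagger>))"
  shows "commuting (modulus (T ^^ k)) (modulus (T\<^sup>\<dagger> ^^ l))"
proof (induction l arbitrary: k)
  case 0
  show ?case unfolding modulus_funpow_0 by (simp add: commuting_def)
next
  case (Suc l)
  let ?B = "modulus (T\<^sup>\<dagger> ^^ l)"
  have B: "selfadjoint ?B" by (rule selfadjoint_op_abs[OF adjoint_pair_funpow[OF adj_T_pair]])
  have BT: "commuting ?B (modulus T)" using commuting_sym[OF Suc.IH[of 1]] by simp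
  have "commuting (conjugate U ?B) (modulus (T ^^ k))"
    using commuting_modulus_funpow_Suc_iff[OF B BT comm] commuting_sym[OF Suc.IH] by blast
  moreover have "modulus (T\<^sup>\<dagger> ^^ Suc l) = (\<lambda>x. modulus (T\<^sup>\<dagger>) (conjugate U ?B x))"
    using polar_decomposed.modulus_funpow_Suc[OF polar_decomposed_adj, of l] BT
    unfolding adj_simps comp_def .
  ultimately show ?case
    using commuting_comp[OF comm commuting_sym] by metis
qed

lemma commuting_moduli_funpow:
  assumes comm: "\<And>n. commuting (modulus (T ^^ n)) (modulus (T\<^sup>\<dagger>))"
  shows "commuting (modulus (T ^^ m)) (modulus (T ^^ n))"
proof (induction m arbitrary: n)
  case 0
  show ?case unfolding modulus_funpow_0 by (simp add: commuting_def)
next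
  case (Suc m)
  show ?case
  proof (cases n)
    case 0
    show ?thesis unfolding \<open>n = 0\<close> modulus_funpow_0 by (simp add: commuting_def)
  next
    case (Suc k)
    let ?W = "\<lambda>n. conjugate (U\<^sup>\<dagger>) (modulus (T ^^ n))"
    note swap = commutingD[OF commuting_modulus_conjugate_adj[OF comm]]
    have "commuting (?W m) (?W k)"
      by (rule polar_decomposed.commuting_conjugate[OF polar_decomposed_adj
            selfadjoint_op_abs[OF adjoint_pair_funpow[OF T_pair]] comm Suc.IH])
    then have "commuting (modulus T \<circ> ?W m) (modulus T \<circ> ?W k)"
      by (simp add: commuting_def flip: swap)
    then show ?thesis unfolding \<open>n = Suc k\<close> modulus_funpow_Suc[OF comm] .
  qed
qed

lemma centered_iff_commuting_modulus_adj:
  "centered ip T \<longleftrightarrow> (\<forall>n\<ge>1. commuting (modulus (T ^^ n)) (modulus (T\<^sup>\<dagger>)))"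
proof
  assume "centered ip T"
  then have "\<forall>n\<ge>1. commuting (modulus (T ^^ n)) (modulus (T\<^sup>\<dagger> ^^ 1))"
    unfolding centered_iff_commuting_moduli[OF T_adjointable] by blast
  then show "\<forall>n\<ge>1. commuting (modulus (T ^^ n)) (modulus (T\<^sup>\<dagger>))" by simp
next
  assume "\<forall>n\<ge>1. commuting (modulus (T ^^ n)) (modulus (T\<^sup>\<dagger>))"
  moreover have "commuting (modulus (T ^^ 0)) (modulus (T\<^sup>\<dagger>))"
    unfolding modulus_funpow_0 by (simp add: commuting_def)
  ultimately have comm: "commuting (modulus (T ^^ n)) (modulus (T\<^sup>\<dagger>))" for n
    by (cases "n = 0") auto
  have "commuting (modulus (T\<^sup>\<dagger> ^^ n)) (modulus (T\<^sup>\<dagger>\<^sup>\<dagger>))" for n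
    using commuting_sym[OF commuting_moduli_funpow_adj_funpow[OF comm, of 1 n]] by simp
  from polar_decomposed.commuting_moduli_funpow[OF polar_decomposed_adj this]
  show "centered ip T"
    unfolding centered_iff_commuting_moduli[OF T_adjointable]
    using commuting_moduli_funpow[OF comm] commuting_moduli_funpow_adj_funpow[OF comm] by blast
qed

lemma centered_iff_commuting_moduli_adj:
  "centered ip T \<longleftrightarrow> (\<forall>m\<ge>1. \<forall>n\<ge>1. commuting (modulus (T ^^ n)) (modulus ((T ^^ m)\<^sup>\<dagger>)))"
proof
  assume "centered ip T"
  then show "\<forall>m\<ge>1. \<forall>n\<ge>1. commuting (modulus (T ^^ n)) (modulus ((T ^^ m)\<^sup>\<dagger>))"
    unfolding centered_iff_commuting_moduli[OF T_adjointable] adj_funpow[OF T_adjointable] by blast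
next
  assume "\<forall>m\<ge>1. \<forall>n\<ge>1. commuting (modulus (T ^^ n)) (modulus ((T ^^ m)\<^sup>\<dagger>))"
  then have "\<forall>n\<ge>1. commuting (modulus (T ^^ n)) (modulus ((T ^^ 1)\<^sup>\<dagger>))" by blast
  then show "centered ip T" unfolding centered_iff_commuting_modulus_adj by simp
qed

lemma centered_iff_commuting_conjugates_moduli:
  "centered ip T
    \<longleftrightarrow> (\<forall>m\<ge>1. \<forall>n\<ge>1. commuting (conjugate (U ^^ m) (modulus T)) (modulus (T ^^ n)))"
  using centered_iff_commuting_modulus_adj commuting_modulus_adj_iff_commuting_conjugates by blast

lemma centered_iff_commuting_conjugates_modulus:
  "centered ip T \<longleftrightarrow> (\<forall>n\<ge>1. commuting (conjugate (U ^^ n) (modulus T)) (modulus T))"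
  using centered_iff_commuting_conjugates_moduli
    commuting_conjugates_iff_commuting_conjugates_modulus by blast

lemma centered_iff_commuting_modulus:
  "centered ip T \<longleftrightarrow> (\<forall>n\<ge>1. commuting (modulus ((T ^^ n)\<^sup>\<dagger>)) (modulus T))"
  using polar_decomposed.centered_iff_commuting_modulus_adj[OF polar_decomposed_adj]
  by (simp add: centered_adj_iff adj_funpow T_adjointable)

lemma centered_iff_commuting_adj_conjugates_modulus_adj:
  "centered ip T \<longleftrightarrow>
    (\<forall>n\<ge>1. commuting (conjugate ((U ^^ n)\<^sup>\<dagger>) (modulus (T\<^sup>\<dagger>))) (modulus (T\<^sup>\<dagger>)))"
  using polar_decomposed.centered_iff_commuting_conjugates_modulus[OF polar_decomposed_adj]
  by (simp add: centered_adj_iff adj_funpow T_adjointable U_adjointable)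

lemma centered_iff_commuting_adj_conjugates_moduli_adj:
  "centered ip T \<longleftrightarrow>
    (\<forall>m\<ge>1. \<forall>n\<ge>1. commuting (conjugate ((U ^^ m)\<^sup>\<dagger>) (modulus (T\<^sup>\<dagger>))) (modulus ((T ^^ n)\<^sup>\<dagger>)))"
  using polar_decomposed.centered_iff_commuting_conjugates_moduli[OF polar_decomposed_adj]
  by (simp add: centered_adj_iff adj_funpow T_adjointable U_adjointable)

lemma commuting_conjugates:
  assumes comm: "\<And>n. commuting (conjugate (U ^^ n) (modulus T)) (modulus T)"
  shows "commuting (conjugate (U ^^ m) (modulus T)) (conjugate (U ^^ n) (modulus T))"
proof (induction m arbitrary: n)
  case 0
  show ?case unfolding conjugate_funpow_0 by (rule commuting_sym[OF comm])
next
  case (Suc m)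
  show ?case
  proof (cases n)
    case 0
    show ?thesis unfolding \<open>n = 0\<close> conjugate_funpow_0 by (rule comm)
  next
    case (Suc k)
    show ?thesis
      unfolding \<open>n = Suc k\<close> conjugate_funpow_Suc[OF U_adjointable]
      by (rule commuting_conjugate[OF selfadjoint_conjugate[OF U_funpow_adjointable
              selfadjoint_modulus] comm Suc.IH])
  qed
qed

lemma commuting_conjugates_adj_conjugates:
  assumes comm: "\<And>n. commuting (conjugate (U ^^ n) (modulus T)) (modulus T)"
  shows "commuting (conjugate (U ^^ m) (modulus T)) (conjugate (U\<^sup>\<dagger> ^^ n) (modulus T))"
proof (induction n arbitrary: m)
  case 0
  show ?case unfolding conjugate_funpow_0 by (rule comm)
next
  case (Suc n)
  show ?case
    unfolding conjugate_funpow_Suc[OF adj_adjointable[OF U_adjointable]]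
    using Suc.IH[of "Suc m"] unfolding conjugate_funpow_Suc[OF U_adjointable]
    by (rule commuting_conjugate_adj[OF selfadjoint_conjugate[OF U_funpow_adjointable
            selfadjoint_modulus] comm])
qed

lemma commuting_adj_conjugates:
  assumes "centered ip T"
  shows "commuting (conjugate (U\<^sup>\<dagger> ^^ m) (modulus T)) (conjugate (U\<^sup>\<dagger> ^^ n) (modulus T))"
proof -
  have shift: "conjugate (U\<^sup>\<dagger> ^^ n) (modulus T) = conjugate (U\<^sup>\<dagger> ^^ Suc n) (modulus (T\<^sup>\<dagger>))" for n
    by (induction n)
      (simp_all only: conjugate_funpow_Suc[OF adj_adjointable[OF U_adjointable]] conjugate_funpow_0
        conjugate_adj_modulus_adj)
  have "commuting (conjugate (U\<^sup>\<dagger> ^^ n) (modulus (T\<^sup>\<dagger>))) (modulus (T\<^sup>\<dagger>))" for n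
    using assms conjugate_funpow_0[of "U\<^sup>\<dagger>" "modulus (T\<^sup>\<dagger>)"] commuting_refl
    unfolding centered_iff_commuting_adj_conjugates_modulus_adj adj_funpow[OF U_adjointable]
    by (cases "n = 0") auto
  from polar_decomposed.commuting_conjugates[OF polar_decomposed_adj this]
  show ?thesis unfolding shift .
qed

lemma centered_iff_commuting_family_conjugates:
  "centered ip T \<longleftrightarrow>
    commuting_family ({modulus T}
      \<union> {conjugate (U ^^ n) (modulus T) | n. n \<ge> 1}
      \<union> {conjugate ((U ^^ n)\<^sup>\<dagger>) (modulus T) | n. n \<ge> 1})" (is "_ \<longleftrightarrow> commuting_family ?F")
proof
  assume centered_T: "centered ip T"
  then have comm: "commuting (conjugate (U ^^ n) (modulus T)) (modulus T)" for n
    using conjugate_funpow_0[of U "modulus T"] commuting_refl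
    unfolding centered_iff_commuting_conjugates_modulus
    by (cases "n = 0") auto
  let ?c = "\<lambda>n. conjugate (U ^^ n) (modulus T)" and ?d = "\<lambda>n. conjugate (U\<^sup>\<dagger> ^^ n) (modulus T)"
  have "modulus T \<in> range ?c" by (rule range_eqI[of _ _ 0]) (simp only: conjugate_funpow_0)
  then have "?F \<subseteq> range ?c \<union> range ?d" unfolding adj_funpow[OF U_adjointable] by blast
  moreover have "commuting A B" if "A \<in> range ?c \<union> range ?d" "B \<in> range ?c \<union> range ?d" for A B
    using that commuting_conjugates[OF comm] commuting_adj_conjugates[OF centered_T]
      commuting_conjugates_adj_conjugates[OF comm]
      commuting_sym[OF commuting_conjugates_adj_conjugates[OF comm]]
    by blast
  ultimately show "commuting_family ?F"
    unfolding commuting_family_def commutator_eq_zero_iff by (meson subsetD)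
next
  assume "commuting_family ?F"
  then show "centered ip T"
    unfolding commuting_family_def commutator_eq_zero_iff centered_iff_commuting_conjugates_modulus
    by blast
qed

lemma commutative_along_of_centered:
  assumes centered_T: "centered ip T" and t: "restricted_seq t" shows "commutative_along ip T t"
proof -
  have "commuting (conjugate (U ^^ t n) (modulus T)) (modulus (T ^^ (n + 1 - t n)))"
    if "n \<ge> 1" for n
  proof -
    have "1 \<le> t n" "1 \<le> n + 1 - t n" using restricted_seqD[OF t that] by simp_all
    then show ?thesis using centered_T unfolding centered_iff_commuting_conjugates_moduli by blast
  qed
  then show ?thesis
    unfolding commutative_along_def commutator_eq_zero_iff conjugate_def[symmetric]
    using polar by blast
qed

end

lemma (in formally_real_module) centered_of_commutative_along:
  assumes T: "T \<in> adjointable ip" and t: "restricted_seq t" "commutative_along ip T t"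
  shows "centered ip T"
proof -
  obtain U where U: "polar_decomposition ip T U"
    and comm: "\<And>n. n \<ge> 1 \<Longrightarrow>
      commuting (conjugate (U ^^ t n) (modulus T)) (modulus (T ^^ (n + 1 - t n)))"
    using t(2) unfolding commutative_along_def commutator_eq_zero_iff conjugate_def[symmetric]
    by blast
  interpret polar_decomposed ip T U by unfold_locales (rule T U)+
  show ?thesis
    unfolding centered_iff_commuting_conjugates_moduli
    using commuting_conjugates_of_restricted[OF t(1) comm] by blast
qed

context polar_decomposed
begin

lemma centered_iff_commutative_along_all:
  "centered ip T \<longleftrightarrow> (\<forall>t. restricted_seq t \<longrightarrow> commutative_along ip T t)"
  and centered_iff_commutative_along_some:
  "centered ip T \<longleftrightarrow> (\<exists>t. restricted_seq t \<and> commutative_along ip T t)"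
proof -
  have "restricted_seq (\<lambda>_. 1)" by (simp add: restricted_seq_def)
  then show "centered ip T \<longleftrightarrow> (\<forall>t. restricted_seq t \<longrightarrow> commutative_along ip T t)"
    "centered ip T \<longleftrightarrow> (\<exists>t. restricted_seq t \<and> commutative_along ip T t)"
    using commutative_along_of_centered centered_of_commutative_along[OF T_adjointable] by blast+
qed

end

theorem theorem4p6:
  fixes act :: "'h::complex_banach \<Rightarrow> 'a::cstar_algebra \<Rightarrow> 'h"
    and ip :: "'h \<Rightarrow> 'h \<Rightarrow> 'a"
    and T U :: "'h \<Rightarrow> 'h"
  assumes "hilbert_cstar_module act ip"
    and "T \<in> adjointable ip"
    and "polar_decomposition ip T U"
  shows
    "(centered ip T \<longleftrightarrow>
       (\<forall>m\<ge>1. \<forall>n\<ge>1. commutator (op_abs ip (T ^^ n)) (op_abs ip (adj ip (T ^^ m))) = (\<lambda>_. 0)))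
     \<and> (centered ip T \<longleftrightarrow>
       (\<forall>n\<ge>1. commutator (op_abs ip (T ^^ n)) (op_abs ip (adj ip T)) = (\<lambda>_. 0)))
     \<and> (centered ip T \<longleftrightarrow>
       (\<forall>t. restricted_seq t \<longrightarrow> commutative_along ip T t))
     \<and> (centered ip T \<longleftrightarrow>
       (\<exists>t. restricted_seq t \<and> commutative_along ip T t))
     \<and> (centered ip T \<longleftrightarrow>
       (\<forall>m\<ge>1. \<forall>n\<ge>1. commutator (U ^^ m \<circ> op_abs ip T \<circ> adj ip (U ^^ m)) (op_abs ip (T ^^ n)) = (\<lambda>_. 0)))
     \<and> (centered ip T \<longleftrightarrow>
       (\<forall>n\<ge>1. commutator (U ^^ n \<circ> op_abs ip T \<circ> adj ip (U ^^ n)) (op_abs ip T) = (\<lambda>_. 0)))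
     \<and> (centered ip T \<longleftrightarrow>
       (\<forall>n\<ge>1. commutator (op_abs ip (adj ip (T ^^ n))) (op_abs ip T) = (\<lambda>_. 0)))
     \<and> (centered ip T \<longleftrightarrow>
       (\<forall>n\<ge>1. commutator (adj ip (U ^^ n) \<circ> op_abs ip (adj ip T) \<circ> U ^^ n) (op_abs ip (adj ip T)) = (\<lambda>_. 0)))
     \<and> (centered ip T \<longleftrightarrow>
       (\<forall>m\<ge>1. \<forall>n\<ge>1. commutator (adj ip (U ^^ m) \<circ> op_abs ip (adj ip T) \<circ> U ^^ m) (op_abs ip (adj ip (T ^^ n))) = (\<lambda>_. 0)))
     \<and> (centered ip T \<longleftrightarrow>
       commuting_family
         ({op_abs ip T}
          \<union> {U ^^ n \<circ> op_abs ip T \<circ> adj ip (U ^^ n) | n. n \<ge> 1}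
          \<union> {adj ip (U ^^ n) \<circ> op_abs ip T \<circ> U ^^ n | n. n \<ge> 1}))"
proof -
  interpret hilbert_cstar_module act ip by (rule assms(1))
  interpret polar_decomposed ip T U by unfold_locales (rule assms(2,3))+
  have adj_conjugate: "adj ip (U ^^ n) \<circ> R \<circ> U ^^ n = conjugate (adj ip (U ^^ n)) R" for n R
    by (simp add: conjugate_def adj_adj[OF U_funpow_adjointable])
  show ?thesis
    unfolding commutator_eq_zero_iff adj_conjugate conjugate_def[symmetric]
    by (intro conjI centered_iff_commuting_moduli_adj centered_iff_commuting_modulus_adj
        centered_iff_commutative_along_all centered_iff_commutative_along_some
        centered_iff_commuting_conjugates_moduli centered_iff_commuting_conjugates_modulus
        centered_iff_commuting_modulus centered_iff_commuting_adj_conjugates_modulus_adj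
        centered_iff_commuting_adj_conjugates_moduli_adj centered_iff_commuting_family_conjugates)
qed

end
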